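(* Consider the initial value problem $y'(t)+My(t)=f(y(t))$, $y(t_0)=y_0$, with a constant $m\times m$ matrix $M$ and a sufficiently smooth $f$, and the two-stage implicit SVERK method with real coefficients $a_{ij},b_i$ ($i,j=1,2$), $c_1=a_{11}+a_{12}$, $c_2=a_{21}+a_{22}$, $$\begin{aligned}Y_1&=e^{-c_1hM}y_0+h\big[a_{11}f(Y_1)+a_{12}f(Y_2)\big],\\ Y_2&=e^{-c_2hM}y_0+h\big[a_{21}f(Y_1)+a_{22}f(Y_2)\big],\\ y_1&=e^{-hM}y_0+h\big(b_1f(Y_1)+b_2f(Y_2)\big)+w_4(z),\end{aligned}$$ where, with $g(y_0)=-My_0+f(y_0)$, $$\begin{aligned}w_4(z)=&-\frac{h^2}{2!}Mf(y_0)+\frac{h^3}{3!}\Big((M-f'_y(y_0))Mf(y_0)-Mf'_y(y_0)g(y_0)\Big)\\&+\frac{h^4}{4!}\Big((-M+f'_y(y_0))M^2f(y_0)+M^2f'_y(y_0)g(y_0)-Mf''_{yy}(y_0)\big(g(y_0),g(y_0)\big)\\&\quad-Mf'_y(y_0)(-M+f'_y(y_0))g(y_0)-f'_y(y_0)Mf'_y(y_0)g(y_0)-f'_y(y_0)f'_y(y_0)Mf(y_0)\\&\quad+3f''_{yy}(y_0)\big(-Mf(y_0),g(y_0)\big)\Big).\end{aligned}$$ Suppose the coefficients satisfy $$\begin{aligned}&b_1+b_2=1,\qquad b_1c_1+b_2c_2=\tfrac12,\qquad b_1c_1^2+b_2c_2^2=\tfrac13,\\&b_1(a_{11}c_1+a_{12}c_2)+b_2(a_{21}c_1+a_{22}c_2)=\tfrac16,\qquad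 b_1c_1^3+b_2c_2^3=\tfrac14,\\&b_1c_1(a_{11}c_1+a_{12}c_2)+b_2c_2(a_{21}c_1+a_{22}c_2)=\tfrac18,\\&b_1(a_{11}c_1^2+a_{12}c_2^2)+b_2(a_{21}c_1^2+a_{22}c_2^2)=\tfrac1{12},\\&(b_1a_{11}+b_2a_{21})(a_{11}c_1+a_{12}c_2)+(b_1a_{12}+b_2a_{22})(a_{21}c_1+a_{22}c_2)=\tfrac1{24}.\end{aligned}$$ Then the method has order four.
   Context: A one-step method has order $p$ if, for $y_0=y(t_0)$, the Taylor expansions in $h$ of the numerical solution $y_1$ after one step and of the exact solution $y(t_0+h)$ coincide up to and including the $h^p$ term (so here $y_1-y(t_0+h)=\mathcal O(h^5)$ as $h\to0$). This is classical (non-stiff) order: $M$ and $f$ are fixed as $h\to0$. The stages $Y_1,Y_2$ are the solution of the implicit equations near $y_0$ for small $h$. $f'_y(y_0)$ is the Jacobian of $f$ at $y_0$ and $f''_{yy}(y_0)(\cdot,\cdot)$ is the second derivative of $f$ at $y_0$, a symmetric bilinear map. *)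

theory Defs
  imports "HOL-Analysis.Analysis" "HOL-Library.Landau_Symbols"
begin

(* The type real^'m^'m carries no power or exp for the matrix product
   (its ring multiplication is componentwise). *)

primrec matpow :: "real^'m^'m \<Rightarrow> nat \<Rightarrow> real^'m^'m" where
  "matpow A 0 = mat 1"
| "matpow A (Suc n) = A ** matpow A n"

definition mexp :: "real^'m^'m \<Rightarrow> real^'m^'m" where
  "mexp A = (\<Sum>n. matpow A n /\<^sub>R fact n)"

(* Class C^k; intended for open S and finite-dimensional 'a, where k-fold continuous
   differentiability is the same as that of all iterated directional derivatives. *)

primrec Ck_on :: "nat \<Rightarrow> 'a::euclidean_space set \<Rightarrow> ('a \<Rightarrow> 'b::real_normed_vector) \<Rightarrow> bool" where
  "Ck_on 0 S f \<longleftrightarrow> continuous_on S f"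
| "Ck_on (Suc k) S f \<longleftrightarrow>
     (\<forall>x\<in>S. f differentiable (at x)) \<and> (\<forall>v. Ck_on k S (\<lambda>x. frechet_derivative f (at x) v))"

definition second_derivative :: "(real^'m \<Rightarrow> real^'m) \<Rightarrow> real^'m \<Rightarrow> real^'m \<Rightarrow> real^'m \<Rightarrow> real^'m" where
  "second_derivative f x u v =
     frechet_derivative (\<lambda>z. frechet_derivative f (at z) v) (at x) u"

definition vector_field :: "real^'m^'m \<Rightarrow> (real^'m \<Rightarrow> real^'m) \<Rightarrow> real^'m \<Rightarrow> real^'m" where
  "vector_field M f x = - (M *v x) + f x"

definition w4 :: "real^'m^'m \<Rightarrow> (real^'m \<Rightarrow> real^'m) \<Rightarrow> real^'m \<Rightarrow> real \<Rightarrow> real^'m" where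
  "w4 M f y0 h =
    (let J = jacobian f (at y0); F2 = second_derivative f y0;
         f0 = f y0; g = vector_field M f y0
     in - ((h^2 / fact 2) *\<^sub>R (M *v f0))
        + (h^3 / fact 3) *\<^sub>R ((M - J) *v (M *v f0) - M *v (J *v g))
        + (h^4 / fact 4) *\<^sub>R
            ((- M + J) *v (M *v (M *v f0)) + M *v (M *v (J *v g)) - M *v F2 g g
             - M *v (J *v ((- M + J) *v g)) - J *v (M *v (J *v g)) - J *v (J *v (M *v f0))
             + 3 *\<^sub>R F2 (- (M *v f0)) g))"

definition sverk_stages ::
  "real^2^2 \<Rightarrow> real^2 \<Rightarrow> real^'m^'m \<Rightarrow> (real^'m \<Rightarrow> real^'m) \<Rightarrow> real^'m \<Rightarrow> real \<Rightarrow> (real^'m)^2 \<Rightarrow> bool" where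
  "sverk_stages a c M f y0 h Y \<longleftrightarrow>
     (\<forall>i. Y $ i = mexp (- ((c $ i * h) *\<^sub>R M)) *v y0 + h *\<^sub>R (\<Sum>j\<in>UNIV. a $ i $ j *\<^sub>R f (Y $ j)))"

definition sverk_update ::
  "real^2 \<Rightarrow> real^'m^'m \<Rightarrow> (real^'m \<Rightarrow> real^'m) \<Rightarrow> real^'m \<Rightarrow> real \<Rightarrow> (real^'m)^2 \<Rightarrow> real^'m" where
  "sverk_update b M f y0 h Y =
     mexp (- (h *\<^sub>R M)) *v y0 + h *\<^sub>R (\<Sum>i\<in>UNIV. b $ i *\<^sub>R f (Y $ i)) + w4 M f y0 h"

(* T 0, ..., T p are the coefficients of the Taylor expansion of F in h, as h tends to 0 within H,
   up to and including the h^p term. *)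

definition taylor_expansion_upto :: "nat \<Rightarrow> real set \<Rightarrow> (real \<Rightarrow> real^'m) \<Rightarrow> (nat \<Rightarrow> real^'m) \<Rightarrow> bool" where
  "taylor_expansion_upto p H F T \<longleftrightarrow>
     (\<lambda>h. norm (F h - (\<Sum>k\<le>p. h^k *\<^sub>R T k))) \<in> O[at 0 within H](\<lambda>h. h^(p+1))"

definition taylor_expansions_coincide ::
  "nat \<Rightarrow> real set \<Rightarrow> (real \<Rightarrow> real^'m) \<Rightarrow> (real \<Rightarrow> real^'m) \<Rightarrow> bool" where
  "taylor_expansions_coincide p H F G \<longleftrightarrow>
     (\<exists>T. taylor_expansion_upto p H F T \<and> taylor_expansion_upto p H G T)"

lemma taylor_expansions_coincide_imp_bigo:
  assumes "taylor_expansions_coincide p H F G"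
  shows "(\<lambda>h. norm (F h - G h)) \<in> O[at 0 within H](\<lambda>h. h^(p+1))"
proof -
  obtain T where T: "taylor_expansion_upto p H F T" "taylor_expansion_upto p H G T"
    using assms unfolding taylor_expansions_coincide_def by blast
  let ?P = "\<lambda>h. \<Sum>k\<le>p. h^k *\<^sub>R T k"
  have "(\<lambda>h. norm (F h - ?P h) + norm (G h - ?P h)) \<in> O[at 0 within H](\<lambda>h. h^(p+1))"
    using T unfolding taylor_expansion_upto_def by (rule sum_in_bigo)
  moreover have "(\<lambda>h. norm (F h - G h)) \<in>
      O[at 0 within H](\<lambda>h. norm (F h - ?P h) + norm (G h - ?P h))"
  proof (rule landau_o.big_mono, rule always_eventually, rule allI)
    fix h
    show "norm (norm (F h - G h)) \<le> norm (norm (F h - ?P h) + norm (G h - ?P h))"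
      using norm_triangle_ineq4[of "F h - ?P h" "G h - ?P h"] by simp
  qed
  ultimately show ?thesis
    by (rule landau_o.big_trans[rotated])
qed

(* Order p on the problem y' + M y = f(y), y(t0) = y0 with solution y on the interval I.
   The stages are the solution of the implicit equations near y0: for small h there is exactly one
   in a fixed ball around y0.  Steps h are those with t0 + h in I, so I = {t0..T} gives positive
   steps and an interval around t0 gives steps of either sign. *)

definition sverk_has_order ::
  "nat \<Rightarrow> real^2^2 \<Rightarrow> real^2 \<Rightarrow> real^2 \<Rightarrow> real^'m^'m \<Rightarrow> (real^'m \<Rightarrow> real^'m) \<Rightarrow>
     real \<Rightarrow> real^'m \<Rightarrow> real set \<Rightarrow> (real \<Rightarrow> real^'m) \<Rightarrow> bool" where
  "sverk_has_order p a b c M f t0 y0 I y \<longleftrightarrow>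
     (\<exists>r>0.
        (\<forall>\<^sub>F h in nhds 0. \<exists>!Y. (\<forall>i. Y $ i \<in> ball y0 r) \<and> sverk_stages a c M f y0 h Y) \<and>
        (\<forall>Y. (\<forall>\<^sub>F h in at 0 within {h. t0 + h \<in> I}.
                (\<forall>i. Y h $ i \<in> ball y0 r) \<and> sverk_stages a c M f y0 h (Y h)) \<longrightarrow>
             taylor_expansions_coincide p {h. t0 + h \<in> I}
               (\<lambda>h. sverk_update b M f y0 h (Y h)) (\<lambda>h. y (t0 + h))))"

end

theory Submission
  imports Defs
begin

text \<open>Expansions \<open>F h = (\<Sum>k\<le>p. h\<^sup>k T k) + O(h\<^bsup>p+1\<^esup>)\<close> are closed under sums, linear maps, multiplication by \<open>h\<close>,
  integration, and composition with a \<open>C\<^bsup>p+1\<^esup>\<close> map. Both the stage equations and the differential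
  equation express the order \<open>p + 1\<close> expansion of the unknown through the order \<open>p\<close> expansion of
  \<open>f\<close> along it, so starting from \<open>y\<^sub>0 + O(h)\<close> the coefficients are found one after the other. The order
  conditions make the elementary differentials of \<open>f\<close> agree, and \<open>w\<^sub>4\<close> supplies the terms with \<open>M\<close>
  that are missing. Unique solvability of the stages is Banach's fixed point theorem.\<close>

subsection \<open>Calculus of Taylor expansions\<close>

text \<open>The steps may lie on one side of \<open>0\<close> only, and the stages are given as an
  arbitrary family of solutions, not known to be differentiable in \<open>h\<close>. Remainder
  bounds therefore replace derivatives of the unknown: a function with an expansion is exchanged for
  its Taylor polynomial, which can be differentiated, and a Lipschitz bound for \<open>f\<close>
  absorbs the error. Composition to order \<open>p\<close> costs \<open>p + 1\<close> derivatives of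
  \<open>f\<close>. The factor \<open>h\<close> in the method and the integration of the
  differential equation each supply one order, so \<open>f\<close> is composed to order three only,
  and class four is enough for order four. The final comparison becomes linear algebra once
  \<open>f y0\<close> is written as \<open>g + M *v y0\<close>. Because \<open>c\<close> holds the
  row sums of \<open>a\<close>, each stage starts as \<open>y0 + h c g\<close>. The exponential in
  the update yields the pure powers of \<open>M\<close> at \<open>y0\<close>, the order conditions
  fix the weights of what the stages contribute, and \<open>w4\<close> has to be the difference to
  the exact solution.\<close>

lemma taylor_expansion_iff:
  "taylor_expansion_upto p H F T \<longleftrightarrow>
     (\<exists>C\<ge>0. \<exists>d>0. \<forall>h\<in>H. h \<noteq> 0 \<and> \<bar>h\<bar> < d \<longrightarrow>
        norm (F h - (\<Sum>k\<le>p. h^k *\<^sub>R T k)) \<le> C * \<bar>h\<bar>^(p+1))"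
proof
  assume "taylor_expansion_upto p H F T"
  then obtain C where "C > 0" and
    ev: "\<forall>\<^sub>F h in at 0 within H. norm (F h - (\<Sum>k\<le>p. h^k *\<^sub>R T k)) \<le> C * \<bar>h\<bar>^(p+1)"
    unfolding taylor_expansion_upto_def
    by (elim landau_o.bigE) (auto simp: power_abs abs_mult)
  from ev obtain d where "d > 0"
    "\<forall>h\<in>H. h \<noteq> 0 \<and> \<bar>h\<bar> < d \<longrightarrow> norm (F h - (\<Sum>k\<le>p. h^k *\<^sub>R T k)) \<le> C * \<bar>h\<bar>^(p+1)"
    unfolding eventually_at by auto
  with \<open>C > 0\<close> show "\<exists>C\<ge>0. \<exists>d>0. \<forall>h\<in>H. h \<noteq> 0 \<and> \<bar>h\<bar> < d \<longrightarrow>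
        norm (F h - (\<Sum>k\<le>p. h^k *\<^sub>R T k)) \<le> C * \<bar>h\<bar>^(p+1)"
    by (intro exI[of _ C]) auto
next
  assume "\<exists>C\<ge>0. \<exists>d>0. \<forall>h\<in>H. h \<noteq> 0 \<and> \<bar>h\<bar> < d \<longrightarrow>
        norm (F h - (\<Sum>k\<le>p. h^k *\<^sub>R T k)) \<le> C * \<bar>h\<bar>^(p+1)"
  then obtain C d where "d > 0" "\<forall>h\<in>H. h \<noteq> 0 \<and> \<bar>h\<bar> < d \<longrightarrow>
        norm (F h - (\<Sum>k\<le>p. h^k *\<^sub>R T k)) \<le> C * \<bar>h\<bar>^(p+1)" by blast
  then show "taylor_expansion_upto p H F T"
    unfolding taylor_expansion_upto_def eventually_at
    by (intro bigoI[of _ C]) (auto simp: eventually_at power_abs abs_mult intro!: exI[of _ d])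
qed

lemma taylor_expansionI:
  assumes "C \<ge> 0" "d > 0"
    and "\<And>h. h \<in> H \<Longrightarrow> h \<noteq> 0 \<Longrightarrow> \<bar>h\<bar> < d \<Longrightarrow>
      norm (F h - (\<Sum>k\<le>p. h^k *\<^sub>R T k)) \<le> C * \<bar>h\<bar>^(p+1)"
  shows "taylor_expansion_upto p H F T"
  using assms unfolding taylor_expansion_iff by blast

lemma taylor_expansion_cong:
  assumes "\<forall>\<^sub>F h in at 0 within H. F h = G h" and "\<And>k. k \<le> p \<Longrightarrow> S k = T k"
  shows "taylor_expansion_upto p H F S \<longleftrightarrow> taylor_expansion_upto p H G T"
proof -
  have eq: "(\<Sum>k\<le>p. h^k *\<^sub>R S k) = (\<Sum>k\<le>p. h^k *\<^sub>R T k)" for h :: real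
    by (intro sum.cong) (auto simp: assms)
  show ?thesis unfolding taylor_expansion_upto_def eq
    by (rule landau_o.big.in_cong, use assms(1) in eventually_elim) simp
qed

lemma taylor_expansion_coeff_cong:
  assumes "taylor_expansion_upto p H F S" and "\<And>k. k \<le> p \<Longrightarrow> S k = T k"
  shows "taylor_expansion_upto p H F T"
  using assms taylor_expansion_cong[of F F H p S T] by simp

lemma taylor_expansion_add:
  assumes "taylor_expansion_upto p H F S" "taylor_expansion_upto p H G T"
  shows "taylor_expansion_upto p H (\<lambda>h. F h + G h) (\<lambda>k. S k + T k)"
proof -
  let ?D = "\<lambda>F T h. norm (F h - (\<Sum>k\<le>p. h^k *\<^sub>R T k) :: real^'a)"
  have "(\<lambda>h. ?D F S h + ?D G T h) \<in> O[at 0 within H](\<lambda>h. h^(p+1))"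
    using assms unfolding taylor_expansion_upto_def by (rule sum_in_bigo)
  moreover have "(\<lambda>h. ?D (\<lambda>h. F h + G h) (\<lambda>k. S k + T k) h) \<in> O[at 0 within H](\<lambda>h. ?D F S h + ?D G T h)"
  proof (rule landau_o.big_mono, rule always_eventually, rule allI)
    fix h
    show "norm (?D (\<lambda>h. F h + G h) (\<lambda>k. S k + T k) h) \<le> norm (?D F S h + ?D G T h)"
      using norm_triangle_ineq[of "F h - (\<Sum>k\<le>p. h^k *\<^sub>R S k)" "G h - (\<Sum>k\<le>p. h^k *\<^sub>R T k)"]
      by (simp add: scaleR_add_right sum.distrib algebra_simps)
  qed
  ultimately show ?thesis unfolding taylor_expansion_upto_def by (rule landau_o.big_trans[rotated])
qed

lemma taylor_expansion_linear:
  assumes "bounded_linear L" and "taylor_expansion_upto p H F T"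
  shows "taylor_expansion_upto p H (\<lambda>h. L (F h)) (\<lambda>k. L (T k))"
proof -
  interpret bounded_linear L by fact
  obtain K where K: "K > 0" "\<And>x. norm (L x) \<le> norm x * K" using pos_bounded by blast
  let ?R = "\<lambda>h. F h - (\<Sum>k\<le>p. h^k *\<^sub>R T k)"
  have "(\<lambda>h. norm (L (?R h))) \<in> O[at 0 within H](\<lambda>h. norm (?R h))"
    using K by (intro bigoI[of _ K] always_eventually) (auto simp: mult.commute)
  also have "(\<lambda>h. norm (?R h)) \<in> O[at 0 within H](\<lambda>h. h^(p+1))"
    using assms(2) by (simp add: taylor_expansion_upto_def)
  finally show ?thesis by (simp add: taylor_expansion_upto_def diff sum scaleR)
qed

lemma taylor_expansion_const:
  "taylor_expansion_upto p H (\<lambda>h. x) (\<lambda>k. if k = 0 then x else 0)"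
proof -
  have "(\<Sum>k\<le>p. h^k *\<^sub>R (if k = 0 then x else 0)) = x" for h :: real
    by (subst sum.mono_neutral_right[of _ "{0}"]) auto
  then show ?thesis by (simp add: taylor_expansion_upto_def)
qed

lemma taylor_expansion_sum:
  assumes "finite A" "\<And>i. i \<in> A \<Longrightarrow> taylor_expansion_upto p H (F i) (T i)"
  shows "taylor_expansion_upto p H (\<lambda>h. \<Sum>i\<in>A. F i h) (\<lambda>k. \<Sum>i\<in>A. T i k)"
  using assms
proof (induction A)
  case empty
  show ?case using taylor_expansion_const[of p H 0] by simp
next
  case (insert i A)
  then show ?case by (simp add: taylor_expansion_add)
qed

text \<open>The dropped term is itself O(h^(p+1)), so its norm joins the constant; restricting to
  \<open>\<bar>h\<bar> < 1\<close> lowers the exponent of the old remainder.\<close>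

lemma taylor_expansion_Suc_less:
  assumes "taylor_expansion_upto (Suc p) H F T"
  shows "taylor_expansion_upto p H F T"
proof -
  obtain C d where C: "C \<ge> 0" "d > 0" and
    *: "\<And>h. h \<in> H \<Longrightarrow> h \<noteq> 0 \<Longrightarrow> \<bar>h\<bar> < d \<Longrightarrow> norm (F h - (\<Sum>k\<le>Suc p. h^k *\<^sub>R T k)) \<le> C * \<bar>h\<bar>^(Suc p+1)"
    using assms unfolding taylor_expansion_iff by blast
  show ?thesis
  proof (rule taylor_expansionI[where C = "C + norm (T (Suc p))" and d = "min d 1"])
    fix h assume h: "h \<in> H" "h \<noteq> 0" "\<bar>h\<bar> < min d 1"
    have "norm (F h - (\<Sum>k\<le>p. h^k *\<^sub>R T k)) =
        norm ((F h - (\<Sum>k\<le>Suc p. h^k *\<^sub>R T k)) + h^Suc p *\<^sub>R T (Suc p))" by simp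
    also have "\<dots> \<le> C * \<bar>h\<bar>^(Suc p+1) + \<bar>h\<bar>^Suc p * norm (T (Suc p))"
      using *[of h] h by (intro order.trans[OF norm_triangle_ineq] add_mono) (auto simp: power_abs abs_mult)
    also have "\<dots> \<le> C * \<bar>h\<bar>^Suc p + \<bar>h\<bar>^Suc p * norm (T (Suc p))"
      using h C by (intro add_right_mono mult_left_mono power_decreasing) auto
    finally show "norm (F h - (\<Sum>k\<le>p. h^k *\<^sub>R T k)) \<le> (C + norm (T (Suc p))) * \<bar>h\<bar>^(p+1)"
      by (simp add: algebra_simps)
  qed (use C in auto)
qed

lemma taylor_expansion_mono:
  assumes "taylor_expansion_upto q H F T" "p \<le> q"
  shows "taylor_expansion_upto p H F T"
  using assms(2,1) by (induction rule: inc_induct) (auto dest: taylor_expansion_Suc_less)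

text \<open>The order gained here is what lets the stage recursion climb: order \<open>n\<close> of
  \<open>f\<close> along the stages yields order \<open>n + 1\<close> of the stages.\<close>

lemma taylor_expansion_times_Suc:
  assumes "taylor_expansion_upto p H F T"
  shows "taylor_expansion_upto (Suc p) H (\<lambda>h. h *\<^sub>R F h) (case_nat 0 T)"
proof -
  have "norm (h *\<^sub>R F h - (\<Sum>k\<le>Suc p. h^k *\<^sub>R case_nat 0 T k))
      = \<bar>h\<bar> * norm (F h - (\<Sum>k\<le>p. h^k *\<^sub>R T k))" for h
    by (subst sum.atMost_Suc_shift) (simp flip: scaleR_scaleR scaleR_sum_right scaleR_diff_right)
  moreover have "(\<lambda>h. \<bar>h\<bar> * norm (F h - (\<Sum>k\<le>p. h^k *\<^sub>R T k))) \<in> O[at 0 within H](\<lambda>h. h * h^(p+1))"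
    using assms unfolding taylor_expansion_upto_def by (intro landau_o.big_mult) auto
  ultimately show ?thesis by (simp add: taylor_expansion_upto_def)
qed

lemma taylor_expansion_times:
  assumes "taylor_expansion_upto p H F T"
  shows "taylor_expansion_upto p H (\<lambda>h. h *\<^sub>R F h) (case_nat 0 T)"
  using taylor_expansion_times_Suc[OF assms] by (rule taylor_expansion_Suc_less)

text \<open>The \<open>j\<close> orders gained are given up, so that summands with different
  \<open>j\<close> can be added at a common order.\<close>

lemma taylor_expansion_times_power:
  assumes "taylor_expansion_upto p H F T"
  shows "taylor_expansion_upto p H (\<lambda>h. h^j *\<^sub>R F h) (\<lambda>k. if k < j then 0 else T (k - j))"
proof (induction j)
  case 0
  then show ?case using assms by simp
next
  case (Suc j)
  have "case_nat 0 (\<lambda>k. if k < j then 0 else T (k - j)) = (\<lambda>k. if k < Suc j then 0 else T (k - Suc j))"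
    by (auto split: nat.splits)
  then show ?case using taylor_expansion_times[OF Suc] by simp
qed

lemma onorm_scaleR_left_le:
  fixes x :: "'a::real_normed_vector"
  assumes "norm x \<le> B"
  shows "onorm (\<lambda>t::real. t *\<^sub>R x) \<le> B"
proof (rule onorm_le)
  fix t :: real
  show "norm (t *\<^sub>R x) \<le> B * norm t"
    using mult_right_mono[OF assms, of "\<bar>t\<bar>"] by (simp add: mult.commute)
qed

text \<open>The coefficient at \<open>0\<close> cannot be read off from an expansion along \<open>at 0 within H\<close>,
  hence the hypothesis on \<open>u' 0\<close>.\<close>

lemma taylor_expansion_integrate:
  fixes u u' :: "real \<Rightarrow> real^'m"
  assumes te: "taylor_expansion_upto p H u' T"
    and H: "is_interval H" "0 \<in> H" and r: "r > 0"
    and der: "\<And>h. h \<in> H \<Longrightarrow> \<bar>h\<bar> < r \<Longrightarrow> (u has_vector_derivative u' h) (at h within H)"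
    and u'0: "u' 0 = T 0"
  shows "taylor_expansion_upto (Suc p) H u (case_nat (u 0) (\<lambda>k. T k /\<^sub>R real (Suc k)))"
proof -
  obtain C d where C: "C \<ge> 0" "d > 0" and
    *: "\<And>h. h \<in> H \<Longrightarrow> h \<noteq> 0 \<Longrightarrow> \<bar>h\<bar> < d \<Longrightarrow> norm (u' h - (\<Sum>k\<le>p. h^k *\<^sub>R T k)) \<le> C * \<bar>h\<bar>^(p+1)"
    using te unfolding taylor_expansion_iff by blast
  have "(\<Sum>k\<le>p. 0^k *\<^sub>R T k) = T 0"
    by (subst sum.mono_neutral_right[of _ "{0}"]) auto
  then have bound: "norm (u' h - (\<Sum>k\<le>p. h^k *\<^sub>R T k)) \<le> C * \<bar>h\<bar>^(p+1)" if "h \<in> H" "\<bar>h\<bar> < d" for h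
    using that * u'0 by (cases "h = 0") auto
  let ?S = "case_nat (u 0) (\<lambda>k. T k /\<^sub>R real (Suc k))"
  \<comment> \<open>The derivative of this remainder of \<open>u\<close> is the remainder of
    \<open>u'\<close>. The mean value inequality thus carries the bound over and supplies the extra
    factor \<open>\<bar>h\<bar>\<close>.\<close>
  define w where "w h = u h - (\<Sum>k\<le>Suc p. h^k *\<^sub>R ?S k)" for h
  have w: "w h = u h - (u 0 + (\<Sum>k\<le>p. h^Suc k *\<^sub>R (T k /\<^sub>R real (Suc k))))" for h
    unfolding w_def by (subst sum.atMost_Suc_shift) simp
  have dw: "(w has_vector_derivative (u' h - (\<Sum>k\<le>p. h^k *\<^sub>R T k))) (at h within H)"
    if "h \<in> H" "\<bar>h\<bar> < r" for h
  proof -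
    have "((\<lambda>h. h^Suc k *\<^sub>R (T k /\<^sub>R real (Suc k))) has_vector_derivative h^k *\<^sub>R T k) (at h within H)" for k
    proof -
      have "((\<lambda>h. h^Suc k) has_vector_derivative (real (Suc k) * h^k)) (at h within H)"
        unfolding has_real_derivative_iff_has_vector_derivative[symmetric]
        by (rule derivative_eq_intros refl | simp)+
      from bounded_linear.has_vector_derivative[OF bounded_linear_scaleR_left this, of "T k /\<^sub>R real (Suc k)"]
      moreover have "(real (Suc k) * h^k) *\<^sub>R (T k /\<^sub>R real (Suc k)) = h^k *\<^sub>R T k" by simp
      ultimately show ?thesis by (simp only:)
    qed
    then have "((\<lambda>h. u 0 + (\<Sum>k\<le>p. h^Suc k *\<^sub>R (T k /\<^sub>R real (Suc k)))) has_vector_derivative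
        0 + (\<Sum>k\<le>p. h^k *\<^sub>R T k)) (at h within H)"
      by (intro has_vector_derivative_add has_vector_derivative_const has_vector_derivative_sum)
    from has_vector_derivative_diff[OF der[OF that] this] show ?thesis unfolding w add_0_left .
  qed
  show ?thesis
  proof (rule taylor_expansionI[where C = C and d = "min d r"])
    fix h assume h: "h \<in> H" "h \<noteq> 0" "\<bar>h\<bar> < min d r"
    \<comment> \<open>Convex, contains \<open>0\<close> and \<open>h\<close> even when
      \<open>H\<close> is one-sided, and keeps \<open>\<bar>x\<bar> \<le> \<bar>h\<bar>\<close>,
      which makes the bound on the derivative uniform.\<close>
    let ?I = "H \<inter> cball 0 \<bar>h\<bar>"
    have "norm (w h - w 0) \<le> C * \<bar>h\<bar>^(p+1) * norm (h - 0)"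
    proof (rule differentiable_bound)
      show "convex ?I" using H by (intro convex_Int is_interval_convex convex_cball)
      fix x assume x: "x \<in> ?I"
      then have xH: "x \<in> H" "\<bar>x\<bar> \<le> \<bar>h\<bar>" by auto
      show "(w has_derivative (\<lambda>t. t *\<^sub>R (u' x - (\<Sum>k\<le>p. x^k *\<^sub>R T k)))) (at x within ?I)"
        using dw[of x] xH h unfolding has_vector_derivative_def
        by (auto intro: has_derivative_subset)
      have "norm (u' x - (\<Sum>k\<le>p. x^k *\<^sub>R T k)) \<le> C * \<bar>x\<bar>^(p+1)" using bound xH h by auto
      also have "\<dots> \<le> C * \<bar>h\<bar>^(p+1)" using xH C by (intro mult_left_mono power_mono) auto
      finally show "onorm (\<lambda>t. t *\<^sub>R (u' x - (\<Sum>k\<le>p. x^k *\<^sub>R T k))) \<le> C * \<bar>h\<bar>^(p+1)"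
        by (rule onorm_scaleR_left_le)
    qed (use h H in auto)
    moreover have "w 0 = 0" by (simp add: w)
    ultimately have "norm (w h) \<le> C * \<bar>h\<bar>^(Suc p + 1)" by (simp add: mult_ac)
    then show "norm (u h - (\<Sum>k\<le>Suc p. h^k *\<^sub>R ?S k)) \<le> C * \<bar>h\<bar>^(Suc p + 1)"
      unfolding w_def .
  qed (use C r in auto)
qed

text \<open>Absolute summability at \<open>h = 1\<close> dominates all
  \<open>\<bar>h\<bar> < 1\<close>: after \<open>h^Suc p\<close> is taken out of the tail, what
  remains is at most the tail of the norms.\<close>

lemma taylor_expansion_powser:
  fixes X :: "nat \<Rightarrow> real^'m"
  assumes "summable (\<lambda>n. norm (X n))"
  shows "taylor_expansion_upto p H (\<lambda>h. \<Sum>n. h^n *\<^sub>R X n) X"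
proof -
  have sum: "summable (\<lambda>n. norm (X (n + Suc p)))" using summable_ignore_initial_segment[OF assms] .
  show ?thesis
  proof (rule taylor_expansionI[where C = "\<Sum>n. norm (X (n + Suc p))" and d = 1])
    fix h :: real assume h: "h \<in> H" "h \<noteq> 0" "\<bar>h\<bar> < 1"
    have le1: "\<bar>h\<bar>^n \<le> 1" for n using h by (simp add: power_le_one)
    have le: "norm (h^n *\<^sub>R x) \<le> norm x" for n and x :: "real^'m"
      using le1[of n] by (simp add: power_abs mult_left_le_one_le)
    have "summable (\<lambda>n. h^n *\<^sub>R X n)"
      by (rule summable_comparison_test'[OF assms, of 0]) (use le in auto)
    then have "(\<Sum>n. h^n *\<^sub>R X n) - (\<Sum>k\<le>p. h^k *\<^sub>R X k) = (\<Sum>n. h^(n + Suc p) *\<^sub>R X (n + Suc p))"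
      by (subst suminf_split_initial_segment[of _ "Suc p"]) (auto simp: lessThan_Suc_atMost)
    also have "norm \<dots> \<le> (\<Sum>n. \<bar>h\<bar>^Suc p * norm (X (n + Suc p)))"
    proof (rule norm_suminf_le)
      show "norm (h^(n + Suc p) *\<^sub>R X (n + Suc p)) \<le> \<bar>h\<bar>^Suc p * norm (X (n + Suc p))" for n
        using mult_right_mono[OF le1[of n], of "\<bar>h\<bar>^Suc p * norm (X (n + Suc p))"]
        by (simp add: power_add power_abs abs_mult mult_ac)
    qed (intro summable_mult sum)
    also have "\<dots> = \<bar>h\<bar>^Suc p * (\<Sum>n. norm (X (n + Suc p)))"
      using sum by (rule suminf_mult)
    finally show "norm ((\<Sum>n. h^n *\<^sub>R X n) - (\<Sum>k\<le>p. h^k *\<^sub>R X k)) \<le> (\<Sum>n. norm (X (n + Suc p))) * \<bar>h\<bar>^(p + 1)"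
      by (simp add: mult.commute)
  qed (simp_all only: suminf_nonneg[OF sum] norm_ge_zero zero_less_one)
qed

text \<open>Tolerance \<open>1\<close> in the definition of the derivative already gives
  \<open>u h = u 0 + O(h)\<close>. This starts the inductions for compositions and for the
  differential equation.\<close>

lemma taylor_expansion_0_differentiable:
  assumes "(u has_vector_derivative u') (at 0 within H)"
  shows "taylor_expansion_upto 0 H u (\<lambda>k. u 0)"
proof -
  obtain d where d: "d > 0"
    "\<And>h. h \<in> H \<Longrightarrow> \<bar>h\<bar> < d \<Longrightarrow> norm (u h - u 0 - h *\<^sub>R u') \<le> \<bar>h\<bar>"
    using assms unfolding has_vector_derivative_def has_derivative_within_alt
    by (auto dest!: spec[of _ "1::real"])
  show ?thesis
  proof (rule taylor_expansionI[where C = "1 + norm u'" and d = d])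
    fix h assume h: "h \<in> H" "h \<noteq> 0" "\<bar>h\<bar> < d"
    have "norm (u h - u 0) \<le> norm (u h - u 0 - h *\<^sub>R u') + norm (h *\<^sub>R u')"
      using norm_triangle_ineq[of "u h - u 0 - h *\<^sub>R u'" "h *\<^sub>R u'"] by simp
    also have "\<dots> \<le> (1 + norm u') * \<bar>h\<bar>" using d(2)[of h] h by (simp add: algebra_simps)
    finally show "norm (u h - (\<Sum>k\<le>0. h^k *\<^sub>R u 0)) \<le> (1 + norm u') * \<bar>h\<bar>^(0+1)" by simp
  qed (use d in auto)
qed

subsection \<open>Functions of class \<open>C\<^sup>k\<close>\<close>

lemma Ck_on_SucD:
  assumes "Ck_on (Suc k) S f"
  shows "x \<in> S \<Longrightarrow> f differentiable (at x)"
    and "Ck_on k S (\<lambda>x. frechet_derivative f (at x) v)"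
  using assms by auto

lemma Ck_on_SucE: "Ck_on (Suc k) S f \<Longrightarrow> Ck_on k S f"
proof (induction k arbitrary: f)
  case 0
  then show ?case
    by (auto intro!: continuous_at_imp_continuous_on differentiable_imp_continuous_within)
next
  case (Suc k)
  show ?case unfolding Ck_on.simps(2)[of k]
    using Suc.IH Suc.prems by (auto simp del: Ck_on.simps dest: Ck_on_SucD)
qed

lemma Ck_on_mono: "Ck_on n S f \<Longrightarrow> k \<le> n \<Longrightarrow> Ck_on k S f"
  by (rotate_tac, induction rule: inc_induct) (auto intro: Ck_on_SucE simp del: Ck_on.simps)

lemma Ck_on_has_derivative:
  "Ck_on (Suc k) S f \<Longrightarrow> x \<in> S \<Longrightarrow> (f has_derivative frechet_derivative f (at x)) (at x)"
  by (auto simp: frechet_derivative_works)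

lemma Ck_on_linear_frechet_derivative:
  "Ck_on (Suc k) S f \<Longrightarrow> x \<in> S \<Longrightarrow> bounded_linear (frechet_derivative f (at x))"
  by (rule has_derivative_bounded_linear[OF Ck_on_has_derivative])

text \<open>\<open>Ck_on\<close> controls one direction at a time. Each partial derivative is
  bounded on the compact set, the sum of these bounds over the basis bounds the operator norm, and
  convexity allows the mean value inequality.\<close>

lemma Ck_on_lipschitz:
  fixes f :: "'a::euclidean_space \<Rightarrow> 'b::real_normed_vector"
  assumes f: "Ck_on (Suc k) S f" and K: "compact K" "convex K" "K \<subseteq> S"
  shows "\<exists>L\<ge>0. \<forall>x\<in>K. \<forall>y\<in>K. norm (f x - f y) \<le> L * norm (x - y)"
proof -
  let ?D = "\<lambda>x. frechet_derivative f (at x)"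
  have "\<exists>B. \<forall>x\<in>K. norm (?D x b) \<le> B" for b
  proof -
    have "Ck_on 0 S (\<lambda>x. ?D x b)" using Ck_on_mono[OF Ck_on_SucD(2)[OF f]] by blast
    then have "continuous_on K (\<lambda>x. ?D x b)" using K continuous_on_subset by auto
    from compact_imp_bounded[OF compact_continuous_image[OF this K(1)]]
    have "bounded ((\<lambda>x. ?D x b) ` K)" .
    then show ?thesis by (auto simp: bounded_iff)
  qed
  then have "\<exists>B. \<forall>b. \<forall>x\<in>K. norm (?D x b) \<le> B b" by (intro choice allI)
  then obtain B where B: "\<And>b x. x \<in> K \<Longrightarrow> norm (?D x b) \<le> B b" by blast
  define L where "L = (\<Sum>b\<in>Basis. \<bar>B b\<bar>)"
  have "norm (f x - f y) \<le> L * norm (x - y)" if "x \<in> K" "y \<in> K" for x y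
  proof (rule differentiable_bound[OF K(2) _ _ that])
    fix z assume z: "z \<in> K"
    then have zS: "z \<in> S" using K by blast
    show "(f has_derivative ?D z) (at z within K)"
      by (rule has_derivative_at_withinI[OF Ck_on_has_derivative[OF f zS]])
    interpret bounded_linear "?D z" using Ck_on_linear_frechet_derivative[OF f zS] .
    show "onorm (?D z) \<le> L"
    proof (rule onorm_le)
      fix v
      have "?D z v = ?D z (\<Sum>b\<in>Basis. (v \<bullet> b) *\<^sub>R b)" by (simp add: euclidean_representation)
      also have "\<dots> = (\<Sum>b\<in>Basis. (v \<bullet> b) *\<^sub>R ?D z b)" by (simp add: sum scaleR)
      also have "norm \<dots> \<le> (\<Sum>b\<in>Basis. norm v * \<bar>B b\<bar>)"
      proof (rule sum_norm_le)
        fix b :: 'a assume b: "b \<in> Basis"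
        have "norm (?D z b) \<le> \<bar>B b\<bar>" using B[OF z, of b] by linarith
        then show "norm ((v \<bullet> b) *\<^sub>R ?D z b) \<le> norm v * \<bar>B b\<bar>"
          using Basis_le_norm[OF b, of v] by (auto intro!: mult_mono)
      qed
      finally show "norm (?D z v) \<le> L * norm v" by (simp add: L_def sum_distrib_left mult.commute)
    qed
  qed
  moreover have "L \<ge> 0" by (auto simp: L_def intro: sum_nonneg)
  ultimately show ?thesis by blast
qed

section \<open>Bilinearity and symmetry of the second derivative\<close>

text \<open>The first derivative is additive in its direction at every point of the open set
  \<open>S\<close>, not just at \<open>x\<close>; an identity valid near \<open>x\<close> may be
  differentiated there.\<close>

lemma frechet_derivative_add_direction:
  assumes f: "Ck_on (Suc (Suc k)) S f" and S: "open S" "x \<in> S"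
  shows "frechet_derivative (\<lambda>z. frechet_derivative f (at z) (u + v)) (at x) =
    (\<lambda>w. frechet_derivative (\<lambda>z. frechet_derivative f (at z) u) (at x) w
       + frechet_derivative (\<lambda>z. frechet_derivative f (at z) v) (at x) w)"
proof -
  have "((\<lambda>z. frechet_derivative f (at z) u + frechet_derivative f (at z) v) has_derivative
    (\<lambda>w. frechet_derivative (\<lambda>z. frechet_derivative f (at z) u) (at x) w
       + frechet_derivative (\<lambda>z. frechet_derivative f (at z) v) (at x) w)) (at x)"
    by (intro has_derivative_add Ck_on_has_derivative[OF Ck_on_SucD(2)[OF f] S(2)])
  moreover have "frechet_derivative f (at z) u + frechet_derivative f (at z) v = frechet_derivative f (at z) (u + v)"
    if "z \<in> S" for z
    using bounded_linear.linear[OF Ck_on_linear_frechet_derivative[OF f that]] by (simp add: linear_add)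
  ultimately have "((\<lambda>z. frechet_derivative f (at z) (u + v)) has_derivative
    (\<lambda>w. frechet_derivative (\<lambda>z. frechet_derivative f (at z) u) (at x) w
       + frechet_derivative (\<lambda>z. frechet_derivative f (at z) v) (at x) w)) (at x)"
    by (rule has_derivative_transform_within_open[OF _ S])
  then show ?thesis by (rule frechet_derivative_at[symmetric])
qed

lemma frechet_derivative_scaleR_direction:
  assumes f: "Ck_on (Suc (Suc k)) S f" and S: "open S" "x \<in> S"
  shows "frechet_derivative (\<lambda>z. frechet_derivative f (at z) (s *\<^sub>R v)) (at x) =
    (\<lambda>w. s *\<^sub>R frechet_derivative (\<lambda>z. frechet_derivative f (at z) v) (at x) w)"
proof -
  have "((\<lambda>z. s *\<^sub>R frechet_derivative f (at z) v) has_derivative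
    (\<lambda>w. s *\<^sub>R frechet_derivative (\<lambda>z. frechet_derivative f (at z) v) (at x) w)) (at x)"
    by (intro has_derivative_scaleR_right Ck_on_has_derivative[OF Ck_on_SucD(2)[OF f] S(2)])
  moreover have "s *\<^sub>R frechet_derivative f (at z) v = frechet_derivative f (at z) (s *\<^sub>R v)"
    if "z \<in> S" for z
    using bounded_linear.linear[OF Ck_on_linear_frechet_derivative[OF f that]] by (simp add: linear_scale)
  ultimately have "((\<lambda>z. frechet_derivative f (at z) (s *\<^sub>R v)) has_derivative
    (\<lambda>w. s *\<^sub>R frechet_derivative (\<lambda>z. frechet_derivative f (at z) v) (at x) w)) (at x)"
    by (rule has_derivative_transform_within_open[OF _ S])
  then show ?thesis by (rule frechet_derivative_at[symmetric])
qed

text \<open>The mixed difference \<open>\<Delta> h = f (x + h u + h v) - f (x + h u) - f (x + h v) + f x\<close> is symmetric in \<open>u\<close>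
  and \<open>v\<close>, and equals \<open>h\<^sup>2 D\<^sub>v D\<^sub>u f x + o(h\<^sup>2)\<close>.\<close>

lemma mixed_difference_bound:
  fixes f :: "'a::euclidean_space \<Rightarrow> 'b::real_normed_vector"
  assumes S: "open S" "x \<in> S" and f: "Ck_on (Suc (Suc k)) S f" and e: "e > 0"
  shows "\<exists>d>0. \<forall>h. 0 < h \<and> h < d \<longrightarrow>
    norm (f (x + h *\<^sub>R u + h *\<^sub>R v) - f (x + h *\<^sub>R u) - f (x + h *\<^sub>R v) + f x
      - h^2 *\<^sub>R frechet_derivative (\<lambda>z. frechet_derivative f (at z) u) (at x) v) \<le> e * h^2"
proof -
  let ?g = "\<lambda>z. frechet_derivative f (at z) u"
  let ?G = "frechet_derivative ?g (at x)"
  have dg: "(?g has_derivative ?G) (at x)"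
    using Ck_on_has_derivative[OF Ck_on_SucD(2)[OF f] S(2)] .
  interpret G: bounded_linear ?G using dg by (rule has_derivative_bounded_linear)
  \<comment> \<open>Both points compared below lie within \<open>h * (norm u + norm v)\<close> of
    \<open>x\<close>, so the two linearisation errors sum to \<open>e / c * h * (c - 1)\<close>. The
    summand \<open>1\<close> keeps \<open>c\<close> positive when \<open>u = v = 0\<close>.\<close>
  define c where "c = 2 * (norm u + norm v) + 1"
  have c: "c > 0" by (auto simp: c_def intro: add_nonneg_pos)
  obtain d where d: "d > 0" "\<And>z. norm (z - x) < d \<Longrightarrow> norm (?g z - ?g x - ?G (z - x)) \<le> e / c * norm (z - x)"
    using dg[unfolded has_derivative_at_alt, THEN conjunct2, rule_format, OF divide_pos_pos[OF e c]] by blast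
  obtain r where r: "r > 0" "ball x r \<subseteq> S" using S open_contains_ball by blast
  define m where "m = min d r / c"
  have m: "m > 0" using d r c by (simp add: m_def)
  show ?thesis
  proof (intro exI[of _ m] conjI allI impI m)
    fix h assume h: "0 < h \<and> h < m"
    have hc: "h * c < d" "h * c < r" using h c by (auto simp: m_def field_simps)
    \<comment> \<open>Increment in direction \<open>v\<close>, followed along \<open>u\<close>,
      minus its expected linear growth. Its change from \<open>0\<close> to \<open>h\<close> is the
      quantity to be bounded, and its derivative involves only the first derivative of
      \<open>f\<close>, which can be linearised at \<open>x\<close>.\<close>
    define \<psi> where "\<psi> s = f (x + h *\<^sub>R v + s *\<^sub>R u) - f (x + s *\<^sub>R u) - (s * h) *\<^sub>R ?G v" for s
    have close: "norm (s *\<^sub>R u) \<le> h * norm u" "norm (h *\<^sub>R v + s *\<^sub>R u) \<le> h * (norm u + norm v)"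
       if "s \<in> {0..h}" for s
    proof -
      show *: "norm (s *\<^sub>R u) \<le> h * norm u" using that by (auto intro: mult_right_mono)
      then show "norm (h *\<^sub>R v + s *\<^sub>R u) \<le> h * (norm u + norm v)"
        using norm_triangle_ineq[of "h *\<^sub>R v" "s *\<^sub>R u"] h by (simp add: algebra_simps)
    qed
    have hle: "h * norm u \<le> h * (norm u + norm v)" "h * (norm u + norm v) < h * c"
      using h by (auto simp: c_def add_nonneg_pos intro!: mult_left_mono)
    have "norm (\<psi> h - \<psi> 0) \<le> e * h * norm (h - 0)"
    proof (rule differentiable_bound[where S = "{0..h}"])
      fix s assume s: "s \<in> {0..h}"
      let ?a = "x + h *\<^sub>R v + s *\<^sub>R u" and ?b = "x + s *\<^sub>R u"
      have na: "norm (?a - x) \<le> h * (norm u + norm v)" and nb: "norm (?b - x) \<le> h * (norm u + norm v)"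
        using close[OF s] hle by (auto simp: add.assoc)
      have inS: "z \<in> S" if "norm (z - x) \<le> h * (norm u + norm v)" for z
        using that hle(2) hc(2) subsetD[OF r(2), of z] by (simp add: dist_norm norm_minus_commute)
      have der: "((\<lambda>s. f (y + s *\<^sub>R u)) has_vector_derivative ?g (y + s *\<^sub>R u)) (at s within {0..h})"
        if "y + s *\<^sub>R u \<in> S" for y
      proof -
        interpret bounded_linear "frechet_derivative f (at (y + s *\<^sub>R u))"
          using Ck_on_linear_frechet_derivative[OF f that] .
        have "((\<lambda>s. y + s *\<^sub>R u) has_derivative (\<lambda>t. t *\<^sub>R u)) (at s within {0..h})"
          by (auto intro!: derivative_eq_intros)
        from has_derivative_compose[OF this Ck_on_has_derivative[OF f that]]
        show ?thesis by (simp add: has_vector_derivative_def scaleR)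
      qed
      have "(\<psi> has_vector_derivative (?g ?a - ?g ?b - h *\<^sub>R ?G v)) (at s within {0..h})"
      proof -
        have "((\<lambda>s. (s * h) *\<^sub>R ?G v) has_vector_derivative h *\<^sub>R ?G v) (at s within {0..h})"
          unfolding has_vector_derivative_def by (auto intro!: derivative_eq_intros)
        then show ?thesis unfolding \<psi>_def
          by (intro has_vector_derivative_diff der inS[OF na] inS[OF nb])
      qed
      then show "(\<psi> has_derivative (\<lambda>t. t *\<^sub>R (?g ?a - ?g ?b - h *\<^sub>R ?G v))) (at s within {0..h})"
        by (simp add: has_vector_derivative_def)
      have "?g ?a - ?g ?b - h *\<^sub>R ?G v = (?g ?a - ?g x - ?G (?a - x)) - (?g ?b - ?g x - ?G (?b - x))"
        by (simp add: G.add G.scaleR algebra_simps)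
      also have "norm \<dots> \<le> e / c * norm (?a - x) + e / c * norm (?b - x)"
        using na nb hle hc by (intro order.trans[OF norm_triangle_ineq4] add_mono d(2)) auto
      also have "\<dots> \<le> e / c * (h * (norm u + norm v)) + e / c * (h * (norm u + norm v))"
        using na nb e c by (intro add_mono mult_left_mono) auto
      also have "\<dots> = e / c * h * (c - 1)" by (simp add: c_def algebra_simps)
      also have "\<dots> \<le> e / c * h * c" using e c h by (intro mult_left_mono) auto
      also have "\<dots> = e * h" using c by simp
      finally show "onorm (\<lambda>t. t *\<^sub>R (?g ?a - ?g ?b - h *\<^sub>R ?G v)) \<le> e * h"
        by (rule onorm_scaleR_left_le)
    qed (use h in auto)
    moreover have "\<psi> h - \<psi> 0 = f (x + h *\<^sub>R u + h *\<^sub>R v) - f (x + h *\<^sub>R u) - f (x + h *\<^sub>R v) + f x - h^2 *\<^sub>R ?G v"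
      by (simp add: \<psi>_def power2_eq_square add_ac)
    ultimately show "norm (f (x + h *\<^sub>R u + h *\<^sub>R v) - f (x + h *\<^sub>R u) - f (x + h *\<^sub>R v) + f x - h^2 *\<^sub>R ?G v) \<le> e * h^2"
      using h by (simp add: power2_eq_square)
  qed
qed

text \<open>Both iterated derivatives approximate the same mixed difference divided by
  \<open>h^2\<close>, so at one small \<open>h\<close> they differ by at most \<open>e\<close>, for
  every \<open>e > 0\<close>.\<close>

lemma frechet_derivative_commute:
  fixes f :: "'a::euclidean_space \<Rightarrow> 'b::real_normed_vector"
  assumes S: "open S" "x \<in> S" and f: "Ck_on (Suc (Suc k)) S f"
  shows "frechet_derivative (\<lambda>z. frechet_derivative f (at z) u) (at x) v =
    frechet_derivative (\<lambda>z. frechet_derivative f (at z) v) (at x) u" (is "?A = ?B")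
proof -
  have "norm (?A - ?B) \<le> 0 + e" if e: "e > 0" for e
  proof -
    let ?\<Delta> = "\<lambda>h. f (x + h *\<^sub>R u + h *\<^sub>R v) - f (x + h *\<^sub>R u) - f (x + h *\<^sub>R v) + f x"
    obtain d where d: "d > 0" "\<And>h. 0 < h \<Longrightarrow> h < d \<Longrightarrow> norm (?\<Delta> h - h^2 *\<^sub>R ?A) \<le> e/2 * h^2"
      using mixed_difference_bound[OF assms half_gt_zero[OF e], of u v] by blast
    obtain d' where d': "d' > 0" "\<And>h. 0 < h \<Longrightarrow> h < d' \<Longrightarrow> norm (?\<Delta> h - h^2 *\<^sub>R ?B) \<le> e/2 * h^2"
      using mixed_difference_bound[OF assms half_gt_zero[OF e], of v u]
      by (auto simp: algebra_simps)
    define h where "h = min d d' / 2"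
    have h: "0 < h" "h < d" "h < d'" using d(1) d'(1) by (auto simp: h_def)
    have "h^2 * norm (?A - ?B) = norm ((?\<Delta> h - h^2 *\<^sub>R ?B) - (?\<Delta> h - h^2 *\<^sub>R ?A))"
      by (simp flip: scaleR_diff_right)
    also have "\<dots> \<le> norm (?\<Delta> h - h^2 *\<^sub>R ?B) + norm (?\<Delta> h - h^2 *\<^sub>R ?A)"
      by (rule norm_triangle_ineq4)
    also have "\<dots> \<le> e/2 * h^2 + e/2 * h^2"
      by (intro add_mono d(2) d'(2) h)
    finally have "h^2 * norm (?A - ?B) \<le> h^2 * e" by (simp add: algebra_simps)
    then show ?thesis using h by simp
  qed
  then have "norm (?A - ?B) \<le> 0" by (rule field_le_epsilon)
  then show ?thesis by simp
qed

subsection \<open>Expansion of a composition\<close>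

text \<open>\<open>composition_coeff f T k\<close> is the coefficient of \<open>h\<^sup>k\<close> in the expansion of \<open>f (v h)\<close> when \<open>v\<close> has
  the coefficients \<open>T\<close>; the recursion comes from integrating
  \<open>(f \<circ> v)' = (\<Sum>j. (j + 1) h\<^sup>j (D f \<circ> v) (T (j + 1)))\<close>.\<close>

function composition_coeff :: "(real^'m \<Rightarrow> real^'n) \<Rightarrow> (nat \<Rightarrow> real^'m) \<Rightarrow> nat \<Rightarrow> real^'n" where
  "composition_coeff f T 0 = f (T 0)"
| "composition_coeff f T (Suc k) = (\<Sum>j\<le>k. real (Suc j) *\<^sub>R
     composition_coeff (\<lambda>x. frechet_derivative f (at x) (T (Suc j))) T (k - j)) /\<^sub>R real (Suc k)"
  by pat_completeness auto
termination by (relation "Wellfounded.measure (\<lambda>(f, T, k). k)") auto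

lemma poly_vector_derivative:
  fixes T :: "nat \<Rightarrow> 'a::real_normed_vector"
  shows "((\<lambda>h. \<Sum>k\<le>N. h^k *\<^sub>R T k) has_vector_derivative (\<Sum>j<N. (real (Suc j) * h^j) *\<^sub>R T (Suc j))) (at h within H)"
proof -
  have "((\<lambda>h. h^k *\<^sub>R T k) has_vector_derivative (real k * h^(k - 1)) *\<^sub>R T k) (at h within H)" for k
  proof -
    have "((\<lambda>h. h^k) has_vector_derivative (real k * h^(k - 1))) (at h within H)"
      unfolding has_real_derivative_iff_has_vector_derivative[symmetric]
      by (rule derivative_eq_intros refl | simp)+
    from bounded_linear.has_vector_derivative[OF bounded_linear_scaleR_left this]
    show ?thesis .
  qed
  then have "((\<lambda>h. \<Sum>k\<le>N. h^k *\<^sub>R T k) has_vector_derivative (\<Sum>k\<le>N. (real k * h^(k - 1)) *\<^sub>R T k)) (at h within H)"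
    by (intro has_vector_derivative_sum)
  moreover have "(\<Sum>k\<le>N. (real k * h^(k - 1)) *\<^sub>R T k) = (\<Sum>j<N. (real (Suc j) * h^j) *\<^sub>R T (Suc j))"
    by (simp add: sum.atMost_shift)
  ultimately show ?thesis by simp
qed

text \<open>The degree \<open>N\<close> is decoupled from the order \<open>n\<close>: the induction
  lowers \<open>n\<close> and replaces \<open>f\<close> by its directional derivatives, while the
  inner polynomial must stay the same.\<close>

lemma taylor_expansion_compose_poly:
  fixes f :: "real^'m \<Rightarrow> real^'n"
  assumes D: "open D" "T 0 \<in> D" and H: "is_interval H" "0 \<in> H"
  shows "Ck_on (Suc n) D f \<Longrightarrow> n \<le> N \<Longrightarrow>
    taylor_expansion_upto n H (\<lambda>h. f (\<Sum>k\<le>N. h^k *\<^sub>R T k)) (composition_coeff f T)"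
proof (induction n arbitrary: f)
  define q where "q h = (\<Sum>k\<le>N. h^k *\<^sub>R T k)" for h
  have q0: "q 0 = T 0" unfolding q_def by (subst sum.mono_neutral_right[of _ "{0}"]) auto
  have dq: "(q has_vector_derivative (\<Sum>j<N. (real (Suc j) * h^j) *\<^sub>R T (Suc j))) (at h within H)" for h
    unfolding q_def by (rule poly_vector_derivative)
  have dfq: "((\<lambda>h. f (q h)) has_vector_derivative
       (\<Sum>j<N. real (Suc j) *\<^sub>R h^j *\<^sub>R frechet_derivative f (at (q h)) (T (Suc j)))) (at h within H)"
    if f: "Ck_on (Suc k) D f" and h: "q h \<in> D" for f :: "real^'m \<Rightarrow> real^'n" and k h
  proof -
    interpret bounded_linear "frechet_derivative f (at (q h))"
      using Ck_on_linear_frechet_derivative[OF f h] .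
    have "((\<lambda>h. f (q h)) has_derivative (\<lambda>t. frechet_derivative f (at (q h)) (t *\<^sub>R (\<Sum>j<N. (real (Suc j) * h^j) *\<^sub>R T (Suc j))))) (at h within H)"
      using has_derivative_compose[where f = q and g = f, OF dq[unfolded has_vector_derivative_def]
          Ck_on_has_derivative[OF f h]] .
    then show ?thesis unfolding has_vector_derivative_def by (simp add: sum scaleR)
  qed
  have "open (q -` D)" unfolding q_def by (intro open_vimage D(1) continuous_intros)
  then obtain r where r: "r > 0" "ball 0 r \<subseteq> q -` D"
    using D(2) q0 by (elim openE) auto
  then have qD: "q h \<in> D" if "\<bar>h\<bar> < r" for h using that by auto
  {
    case 0
    have "taylor_expansion_upto 0 H (\<lambda>h. f (q h)) (\<lambda>k. f (q 0))"
      using taylor_expansion_0_differentiable[OF dfq[of 0 f 0]] 0 q0 D by simp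
    then show ?case unfolding q_def[symmetric] by (rule taylor_expansion_coeff_cong) (simp add: q0)
  next
    case (Suc n)
    let ?Df = "\<lambda>j x. frechet_derivative f (at x) (T (Suc j))"
    let ?c = "\<lambda>k. \<Sum>j<N. real (Suc j) *\<^sub>R (if k < j then 0 else composition_coeff (?Df j) T (k - j))"
    have IH: "taylor_expansion_upto n H (\<lambda>h. ?Df j (q h)) (composition_coeff (?Df j) T)" for j
      using Suc.IH[OF Ck_on_SucD(2)[OF Suc.prems(1), of "T (Suc j)"]] Suc.prems(2) unfolding q_def by simp
    have te: "taylor_expansion_upto n H (\<lambda>h. \<Sum>j<N. real (Suc j) *\<^sub>R h^j *\<^sub>R ?Df j (q h)) ?c"
      by (intro taylor_expansion_sum taylor_expansion_linear[OF bounded_linear_scaleR_right]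
          taylor_expansion_times_power IH) auto
    \<comment> \<open>Integration requires the actual derivative at \<open>0\<close> to be the
      leading coefficient; on both sides only the summand \<open>j = 0\<close> survives.\<close>
    have zero: "(\<Sum>j<N. real (Suc j) *\<^sub>R 0^j *\<^sub>R ?Df j (q 0)) = ?c 0"
      by (intro sum.cong) (auto simp: q0)
    have *: "taylor_expansion_upto (Suc n) H (\<lambda>h. f (q h))
            (case_nat (f (q 0)) (\<lambda>k. ?c k /\<^sub>R real (Suc k)))"
      by (rule taylor_expansion_integrate[OF te H r(1) _ zero]) (rule dfq[OF Suc.prems(1) qD])
    have "case_nat (f (q 0)) (\<lambda>k. ?c k /\<^sub>R real (Suc k)) k = composition_coeff f T k" if "k \<le> Suc n" for k
    proof (cases k)
      case (Suc i)
      \<comment> \<open>Summands with \<open>j > i\<close> vanish, and \<open>i \<le> n < N\<close>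
        ensures that every \<open>j \<le> i\<close> occurs.\<close>
      have "(\<Sum>j<N. real (Suc j) *\<^sub>R (if i < j then 0 else composition_coeff (?Df j) T (i - j))) =
         (\<Sum>j\<le>i. real (Suc j) *\<^sub>R composition_coeff (?Df j) T (i - j))"
        using that \<open>Suc n \<le> N\<close> Suc by (intro sum.mono_neutral_cong_right) auto
      then show ?thesis using Suc by simp
    qed (simp add: q0)
    then show ?case unfolding q_def[symmetric] by (rule taylor_expansion_coeff_cong[OF *])
  }
qed

lemma taylor_expansion_imp_tendsto:
  assumes "taylor_expansion_upto p H v T"
  shows "(v \<longlongrightarrow> T 0) (at 0 within H)"
proof -
  have "taylor_expansion_upto 0 H v T" using taylor_expansion_mono[OF assms] by simp
  then have "(\<lambda>h. norm (v h - T 0)) \<in> O[at 0 within H](\<lambda>h. h)" by (simp add: taylor_expansion_upto_def)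
  then obtain C where "\<forall>\<^sub>F h in at 0 within H. norm (v h - T 0) \<le> C * \<bar>h\<bar>"
    by (elim landau_o.bigE) auto
  moreover have "((\<lambda>h::real. C * \<bar>h\<bar>) \<longlongrightarrow> C * \<bar>0\<bar>) (at 0 within H)" by (intro tendsto_intros)
  ultimately show ?thesis
    by (subst Lim_null) (auto intro: Lim_null_comparison)
qed

text \<open>Since \<open>v\<close> need not be differentiable, it is replaced by its Taylor
  polynomial. Both stay in a compact ball inside \<open>D\<close> for small \<open>h\<close>, where
  the Lipschitz bound turns their distance into a remainder of the same order.\<close>

lemma taylor_expansion_compose:
  fixes f :: "real^'m \<Rightarrow> real^'n"
  assumes D: "open D" "T 0 \<in> D" and H: "is_interval H" "0 \<in> H"
    and f: "Ck_on (Suc p) D f" and v: "taylor_expansion_upto p H v T"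
  shows "taylor_expansion_upto p H (\<lambda>h. f (v h)) (composition_coeff f T)"
proof -
  let ?q = "\<lambda>h. \<Sum>k\<le>p. h^k *\<^sub>R T k"
  obtain r where r: "r > 0" "cball (T 0) r \<subseteq> D" using D open_contains_cball by blast
  obtain L where L: "L \<ge> 0" "\<And>x y. x \<in> cball (T 0) r \<Longrightarrow> y \<in> cball (T 0) r \<Longrightarrow> norm (f x - f y) \<le> L * norm (x - y)"
    using Ck_on_lipschitz[OF f compact_cball convex_cball r(2)] by blast
  have q: "taylor_expansion_upto p H ?q T" by (simp add: taylor_expansion_upto_def)
  have near: "\<forall>\<^sub>F h in at 0 within H. u h \<in> cball (T 0) r" if "taylor_expansion_upto p H u T" for u
    using tendstoD[OF taylor_expansion_imp_tendsto[OF that] r(1)]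
    by eventually_elim (simp add: dist_commute)
  have fq: "taylor_expansion_upto p H (\<lambda>h. f (?q h)) (composition_coeff f T)"
    using taylor_expansion_compose_poly[where n = p and N = p and f = f and T = T, OF D H f] by simp
  have "\<forall>\<^sub>F h in at 0 within H. norm (norm (f (v h) - f (?q h))) \<le> L * norm (norm (v h - ?q h))"
    using near[OF v] near[OF q] by eventually_elim (simp add: L)
  then have "(\<lambda>h. norm (f (v h) - f (?q h))) \<in> O[at 0 within H](\<lambda>h. norm (v h - ?q h))"
    by (rule bigoI)
  also have "(\<lambda>h. norm (v h - ?q h)) \<in> O[at 0 within H](\<lambda>h. h^(p+1))"
    using v by (simp add: taylor_expansion_upto_def)
  finally have "taylor_expansion_upto p H (\<lambda>h. f (v h) - f (?q h)) (\<lambda>k. 0)"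
    by (simp add: taylor_expansion_upto_def)
  from taylor_expansion_add[OF this fq] show ?thesis by simp
qed

subsection \<open>Matrix exponential\<close>

lemma matpow_scaleR: "matpow (s *\<^sub>R A) n = s^n *\<^sub>R matpow A n"
  by (induction n) (auto simp: matrix_scalar_ac scalar_matrix_assoc[symmetric])

text \<open>\<open>K\<close> bounds the linear map that multiplies by \<open>A\<close> from the
  left, so the powers grow at most like \<open>K^n\<close> and the real exponential series of
  \<open>K\<close> is a majorant.\<close>

lemma summable_norm_mexp:
  fixes A :: "real^'a^'a"
  shows "summable (\<lambda>n. norm (matpow A n /\<^sub>R fact n))"
proof -
  have "linear (\<lambda>B::real^'a^'a. A ** B)"
    by (rule linearI) (auto simp: matrix_add_ldistrib matrix_scalar_ac scalar_matrix_assoc)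
  then have "bounded_linear (\<lambda>B::real^'a^'a. A ** B)" by (simp add: linear_conv_bounded_linear)
  from bounded_linear.pos_bounded[OF this] obtain K where K: "K > 0" "\<And>B::real^'a^'a. norm (A ** B) \<le> norm B * K" by blast
  have pow: "norm (matpow A n) \<le> norm (mat 1 :: real^'a^'a) * K^n" for n
  proof (induction n)
    case (Suc n)
    have "norm (matpow A (Suc n)) \<le> norm (matpow A n) * K" using K(2) by simp
    also have "\<dots> \<le> norm (mat 1 :: real^'a^'a) * K^n * K" using Suc K by (intro mult_right_mono) auto
    finally show ?case by (simp add: mult_ac)
  qed simp
  show ?thesis
  proof (rule summable_comparison_test')
    show "summable (\<lambda>n. norm (mat 1 :: real^'a^'a) * (inverse (fact n) * K^n))"
      using summable_exp[of K] by (rule summable_mult)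
    show "norm (norm (matpow A n /\<^sub>R fact n)) \<le> norm (mat 1 :: real^'a^'a) * (inverse (fact n) * K^n)" for n
      using mult_left_mono[OF pow[of n], of "inverse (fact n)"] by (simp add: mult_ac)
  qed
qed

lemma bounded_linear_matrix_vector_mult_left: "bounded_linear (\<lambda>A::real^'n^'m. A *v x)"
proof -
  have "linear (\<lambda>A::real^'n^'m. A *v x)"
    by (rule linearI) (simp_all add: matrix_vector_mult_add_rdistrib scaleR_matrix_vector_assoc[symmetric])
  then show ?thesis by (simp add: linear_conv_bounded_linear)
qed

lemma mexp_mult_vector:
  fixes A :: "real^'n^'n"
  shows "mexp A *v x = (\<Sum>n. (matpow A n *v x) /\<^sub>R fact n)"
    "summable (\<lambda>n. norm ((matpow A n *v x) /\<^sub>R fact n))"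
proof -
  have s: "summable (\<lambda>n. matpow A n /\<^sub>R fact n)"
    by (rule summable_norm_cancel[OF summable_norm_mexp])
  show "mexp A *v x = (\<Sum>n. (matpow A n *v x) /\<^sub>R fact n)"
    using bounded_linear.suminf[OF bounded_linear_matrix_vector_mult_left[of x] s]
    by (simp add: mexp_def scaleR_matrix_vector_assoc[symmetric])
  obtain K where K: "K > 0" "\<And>A::real^'n^'n. norm (A *v x) \<le> norm A * K"
    using bounded_linear.pos_bounded[OF bounded_linear_matrix_vector_mult_left] by blast
  show "summable (\<lambda>n. norm ((matpow A n *v x) /\<^sub>R fact n))"
  proof (rule summable_comparison_test')
    show "summable (\<lambda>n. norm (matpow A n /\<^sub>R fact n) * K)"
      using summable_norm_mexp by (rule summable_mult2)
    show "norm (norm ((matpow A n *v x) /\<^sub>R fact n)) \<le> norm (matpow A n /\<^sub>R fact n) * K" for n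
      using K(2)[of "matpow A n /\<^sub>R fact n"] by (simp add: scaleR_matrix_vector_assoc[symmetric])
  qed
qed

text \<open>Brings the exponential into the form of a power series in \<open>h\<close>; the stages
  use it with \<open>s = c $ i\<close>, the update with \<open>s = 1\<close>.\<close>

lemma mexp_uminus_powser:
  "mexp (- ((s * h) *\<^sub>R M)) *v x = (\<Sum>n. h^n *\<^sub>R (((- s)^n / fact n) *\<^sub>R (matpow M n *v x)))"
proof -
  have "- ((s * h) *\<^sub>R M) = (- s * h) *\<^sub>R M" by simp
  then show ?thesis
    unfolding mexp_mult_vector
    by (simp only: matpow_scaleR power_mult_distrib scaleR_matrix_vector_assoc[symmetric] scaleR_scaleR)
      (simp add: field_simps)
qed

lemma taylor_expansion_mexp:
  "taylor_expansion_upto p H (\<lambda>h. mexp (- ((s * h) *\<^sub>R M)) *v x)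
     (\<lambda>n. ((- s)^n / fact n) *\<^sub>R (matpow M n *v x))"
  unfolding mexp_uminus_powser
proof (rule taylor_expansion_powser)
  show "summable (\<lambda>n. norm (((- s)^n / fact n) *\<^sub>R (matpow M n *v x)))"
    using mexp_mult_vector(2)[of "(- s) *\<^sub>R M" x]
    by (simp only: matpow_scaleR scaleR_matrix_vector_assoc[symmetric] scaleR_scaleR)
      (simp add: field_simps)
qed

lemma mexp_0: "mexp 0 *v x = x"
proof -
  \<comment> \<open>With all parameters \<open>0\<close> the series reduces to its term
    \<open>n = 0\<close>, where \<open>0^0 = 1\<close>.\<close>
  have "mexp (- ((0 * 0) *\<^sub>R 0)) *v x = (\<Sum>n\<in>{0}. 0^n *\<^sub>R (((- 0)^n / fact n) *\<^sub>R (matpow 0 n *v x)))"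
    unfolding mexp_uminus_powser by (rule suminf_finite) auto
  then show ?thesis by simp
qed

text \<open>The filter includes \<open>h = 0\<close> because the stages are claimed to be uniquely
  solvable there too.\<close>

lemma tendsto_mexp: "((\<lambda>h. mexp (- ((s * h) *\<^sub>R M)) *v x) \<longlongrightarrow> x) (nhds 0)"
proof -
  have "((\<lambda>h. mexp (- ((s * h) *\<^sub>R M)) *v x) \<longlongrightarrow> x) (at 0)"
    using taylor_expansion_imp_tendsto[OF taylor_expansion_mexp[of 0 UNIV s M x]] by simp
  then show ?thesis by (simp add: tendsto_nhds_iff mexp_0)
qed

subsection \<open>Stages and exact solution\<close>

lemma norm_vec_le_sum: "norm (x :: 'a::real_normed_vector^'n) \<le> (\<Sum>i\<in>UNIV. norm (x $ i))"
  unfolding norm_vec_def by (rule L2_set_le_sum) simp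

text \<open>Banach's theorem needs a complete set, hence closed balls, whereas the claim is about
  open ones. For small \<open>h\<close> the map sends the closed product ball into the open one, so
  the fixed point lies in it, and uniqueness is inherited from the larger set.\<close>

lemma sverk_stages_ex1:
  fixes a :: "real^2^2" and c :: "real^2" and M :: "real^'m^'m"
  assumes D: "cball y0 r \<subseteq> D" "r > 0" and f: "Ck_on (Suc k) D f"
  shows "\<forall>\<^sub>F h in nhds 0. \<exists>!Y. (\<forall>i. Y $ i \<in> ball y0 r) \<and> sverk_stages a c M f y0 h Y"
proof -
  obtain L where L: "L \<ge> 0" "\<And>x y. x \<in> cball y0 r \<Longrightarrow> y \<in> cball y0 r \<Longrightarrow> norm (f x - f y) \<le> L * norm (x - y)"
    using Ck_on_lipschitz[OF f compact_cball convex_cball D(1)] by blast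
  define B where "B = norm (f y0) + L * r"
  have B: "norm (f x) \<le> B" if "x \<in> cball y0 r" for x
  proof -
    have "norm (f x) \<le> norm (f y0) + norm (f x - f y0)"
      using norm_triangle_ineq[of "f y0" "f x - f y0"] by simp
    also have "norm (f x - f y0) \<le> L * norm (x - y0)" using L(2)[OF that] D(2) by simp
    also have "\<dots> \<le> L * r" using that L(1) by (intro mult_left_mono) (auto simp: dist_norm norm_minus_commute)
    finally show ?thesis by (simp add: B_def)
  qed
  define A where "A = (\<Sum>i\<in>UNIV. \<Sum>j\<in>UNIV. \<bar>a $ i $ j\<bar>)"
  have A: "(\<Sum>j\<in>UNIV. \<bar>a $ i $ j\<bar>) \<le> A" for i
    unfolding A_def by (rule member_le_sum) (auto intro: sum_nonneg)
  have A0: "A \<ge> 0" by (auto simp: A_def intro!: sum_nonneg)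
  define e where "e h i = mexp (- ((c $ i * h) *\<^sub>R M)) *v y0" for h i
  define \<Phi> where "\<Phi> h Y = (\<chi> i. e h i + h *\<^sub>R (\<Sum>j\<in>UNIV. a $ i $ j *\<^sub>R f (Y $ j)))" for h and Y :: "(real^'m)^2"
  have stages: "sverk_stages a c M f y0 h Y \<longleftrightarrow> \<Phi> h Y = Y" for h Y
    by (auto simp: sverk_stages_def \<Phi>_def e_def vec_eq_iff)
  have tsum: "norm (h *\<^sub>R (\<Sum>j\<in>UNIV. a $ i $ j *\<^sub>R g j)) \<le> \<bar>h\<bar> * (A * C)"
    if "\<And>j. norm (g j) \<le> C" for h C i and g :: "2 \<Rightarrow> real^'m"
  proof -
    have C: "C \<ge> 0" by (rule order_trans[OF norm_ge_zero that])
    have "norm (\<Sum>j\<in>UNIV. a $ i $ j *\<^sub>R g j) \<le> (\<Sum>j\<in>UNIV. \<bar>a $ i $ j\<bar> * C)"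
      by (rule sum_norm_le) (simp add: mult_left_mono that)
    also have "\<dots> \<le> A * C" unfolding sum_distrib_right[symmetric] using A C by (intro mult_right_mono)
    finally show ?thesis by (simp add: mult_left_mono)
  qed
  have e_ev: "\<forall>\<^sub>F h in nhds 0. \<forall>i. dist (e h i) y0 < r / 2"
    using tendstoD[OF tendsto_mexp half_gt_zero[OF D(2)]] unfolding e_def
    by (intro eventually_all_finite) blast
  have lim: "((\<lambda>h::real. \<bar>h\<bar> * q) \<longlongrightarrow> 0) (nhds 0)" for q
  proof -
    have "((\<lambda>h::real. \<bar>h\<bar> * q) \<longlongrightarrow> \<bar>0\<bar> * q) (nhds 0)"
      by (intro tendsto_intros filterlim_ident)
    then show ?thesis by simp
  qed
  have ev1: "\<forall>\<^sub>F h::real in nhds 0. \<bar>h\<bar> * (A * B) < r / 2"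
    by (rule order_tendstoD(2)[OF lim half_gt_zero[OF D(2)]])
  \<comment> \<open>The factor \<open>2\<close> counts the stages: the norm of a pair is estimated
    by the sum of two components with the same bound.\<close>
  have ev2: "\<forall>\<^sub>F h::real in nhds 0. \<bar>h\<bar> * (2 * A * L) < 1"
    using order_tendstoD(2)[OF lim] by simp
  show ?thesis
    using e_ev ev1 ev2
  proof eventually_elim
    case (elim h)
    let ?S = "{Y :: (real^'m)^2. \<forall>i. Y $ i \<in> cball y0 r}"
    \<comment> \<open>The strict inequality comes from the exponential part, which stays closer to
      \<open>y0\<close> than \<open>r / 2\<close>.\<close>
    have into: "\<Phi> h Y $ i \<in> ball y0 r" if "Y \<in> ?S" for Y i
    proof -
      have "\<Phi> h Y $ i - y0 = (e h i - y0) + h *\<^sub>R (\<Sum>j\<in>UNIV. a $ i $ j *\<^sub>R f (Y $ j))"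
        by (simp add: \<Phi>_def)
      also have "norm \<dots> \<le> norm (e h i - y0) + norm (h *\<^sub>R (\<Sum>j\<in>UNIV. a $ i $ j *\<^sub>R f (Y $ j)))"
        by (rule norm_triangle_ineq)
      also have "\<dots> < r / 2 + r / 2"
      proof (rule add_less_le_mono)
        show "norm (e h i - y0) < r / 2" using elim(1) by (simp add: dist_norm)
        have "norm (f (Y $ j)) \<le> B" for j using B that by simp
        from order_trans[OF tsum[OF this] less_imp_le[OF elim(2)]]
        show "norm (h *\<^sub>R (\<Sum>j\<in>UNIV. a $ i $ j *\<^sub>R f (Y $ j))) \<le> r / 2" .
      qed
      finally show ?thesis by (simp add: dist_norm norm_minus_commute)
    qed
    have "\<exists>!Y\<in>?S. \<Phi> h Y = Y"
    proof (rule Banach_fix[where c = "\<bar>h\<bar> * (2 * A * L)"])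
      have "closed ?S" 
        by (intro closed_Collect_all closed_vimage[of "cball y0 r", unfolded vimage_def] continuous_intros) auto
      then show "complete ?S" by (simp add: complete_eq_closed)
      show "?S \<noteq> {}" using D(2) by (auto intro!: exI[of _ "\<chi> i. y0"])
      show "\<Phi> h ` ?S \<subseteq> ?S" 
      proof (intro image_subsetI CollectI allI)
        fix Y i assume "Y \<in> ?S"
        from into[OF this, of i] show "\<Phi> h Y $ i \<in> cball y0 r" by simp
      qed
      fix Y Z assume YZ: "Y \<in> ?S" "Z \<in> ?S"
      have "norm (\<Phi> h Y $ i - \<Phi> h Z $ i) \<le> \<bar>h\<bar> * (A * (L * norm (Y - Z)))" for i
      proof -
        have "norm (f (Y $ j) - f (Z $ j)) \<le> L * norm (Y - Z)" for j
        proof -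
          have "norm (f (Y $ j) - f (Z $ j)) \<le> L * norm (Y $ j - Z $ j)" using YZ L(2) by simp
          also have "\<dots> \<le> L * norm (Y - Z)"
            using Finite_Cartesian_Product.norm_nth_le[of "Y - Z" j] L(1) by (intro mult_left_mono) auto
          finally show ?thesis .
        qed
        from tsum[OF this, of h i] show ?thesis
          by (simp add: \<Phi>_def sum_subtractf scaleR_diff_right)
      qed
      then have "(\<Sum>i\<in>UNIV. norm ((\<Phi> h Y - \<Phi> h Z) $ i)) \<le> (\<Sum>i\<in>(UNIV::2 set). \<bar>h\<bar> * (A * (L * norm (Y - Z))))"
        by (intro sum_mono) simp
      then have "norm (\<Phi> h Y - \<Phi> h Z) \<le> (\<Sum>i\<in>(UNIV::2 set). \<bar>h\<bar> * (A * (L * norm (Y - Z))))"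
        by (rule order_trans[OF norm_vec_le_sum])
      then show "dist (\<Phi> h Y) (\<Phi> h Z) \<le> \<bar>h\<bar> * (2 * A * L) * dist Y Z"
        by (simp add: dist_norm mult_ac)
    qed (use elim A0 L in auto)
    then obtain Y where Y: "Y \<in> ?S" "\<Phi> h Y = Y" "\<And>Z. Z \<in> ?S \<Longrightarrow> \<Phi> h Z = Z \<Longrightarrow> Z = Y"
      by (elim ex1E) blast
    show ?case unfolding stages
    proof (intro ex1I[of _ Y] conjI allI)
      show "Y $ i \<in> ball y0 r" for i using into[OF Y(1), of i] Y(2) by simp
      show "Z = Y" if "(\<forall>i. Z $ i \<in> ball y0 r) \<and> \<Phi> h Z = Z" for Z
        using that by (intro Y(3)) (auto intro: less_imp_le)
    qed (rule Y(2))
  qed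
qed

text \<open>The recursion for \<open>S i (Suc k)\<close> reads every \<open>S j\<close> only up to
  index \<open>k\<close>, so it determines the coefficients although the stages are coupled: all of
  them advance one order together. Stating it as a hypothesis allows a closed form to be checked
  against it.\<close>

lemma taylor_expansion_stages:
  fixes a :: "real^2^2" and c :: "real^2" and M :: "real^'m^'m"
    and Y :: "real \<Rightarrow> (real^'m)^2" and S :: "2 \<Rightarrow> nat \<Rightarrow> real^'m"
  assumes D: "open D" "cball y0 r \<subseteq> D" "r > 0" and f: "Ck_on (Suc p) D f"
    and H: "is_interval H" "0 \<in> H"
    and Y: "\<forall>\<^sub>F h in at 0 within H. (\<forall>i. Y h $ i \<in> ball y0 r) \<and> sverk_stages a c M f y0 h (Y h)"
    and S: "\<And>i k. k \<le> p \<Longrightarrow> S i k = ((- (c $ i))^k / fact k) *\<^sub>R (matpow M k *v y0) +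
      (case k of 0 \<Rightarrow> 0 | Suc k \<Rightarrow> \<Sum>j\<in>UNIV. a $ i $ j *\<^sub>R composition_coeff f (S j) k)"
  shows "taylor_expansion_upto p H (\<lambda>h. Y h $ i) (S i)"
proof -
  let ?e = "\<lambda>i h. mexp (- ((c $ i * h) *\<^sub>R M)) *v y0"
  let ?E = "\<lambda>i k. ((- (c $ i))^k / fact k) *\<^sub>R (matpow M k *v y0)"
  let ?s = "\<lambda>i h. \<Sum>j\<in>UNIV. a $ i $ j *\<^sub>R f (Y h $ j)"
  have Y_eq: "\<forall>\<^sub>F h in at 0 within H. ?e i h + h *\<^sub>R ?s i h = Y h $ i" for i
    using Y unfolding sverk_stages_def by (rule eventually_mono) (rule sym, blast)
  have S0: "S i 0 = y0" for i using S[of 0 i] by simp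
  have "taylor_expansion_upto n H (\<lambda>h. Y h $ i) (S i)" if "n \<le> p" for n i
    using that
  proof (induction n arbitrary: i)
    case 0
    \<comment> \<open>Order zero uses only the location of the stages: \<open>f\<close> is bounded
      on the compact ball, so the increment is O(h).\<close>
    have "continuous_on D f" using Ck_on_mono[OF f, of 0] by simp
    from compact_imp_bounded[OF compact_continuous_image[OF continuous_on_subset[OF this D(2)] compact_cball]]
    obtain B where B: "\<And>x. x \<in> cball y0 r \<Longrightarrow> norm (f x) \<le> B" unfolding bounded_iff by blast
    have "\<forall>\<^sub>F h in at 0 within H. norm (norm (h *\<^sub>R ?s i h)) \<le> (\<Sum>j\<in>UNIV. \<bar>a $ i $ j\<bar> * B) * norm h"
      using Y
    proof eventually_elim
      case (elim h)
      have "norm (f (Y h $ j)) \<le> B" for j using elim B by (simp add: less_imp_le)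
      then have "norm (?s i h) \<le> (\<Sum>j\<in>UNIV. \<bar>a $ i $ j\<bar> * B)"
        by (intro sum_norm_le) (simp add: mult_left_mono)
      from mult_left_mono[OF this, of "\<bar>h\<bar>"] show ?case by (simp add: mult.commute)
    qed
    then have "(\<lambda>h. norm (h *\<^sub>R ?s i h)) \<in> O[at 0 within H](\<lambda>h. h)" by (rule bigoI)
    then have "taylor_expansion_upto 0 H (\<lambda>h. h *\<^sub>R ?s i h) (\<lambda>k. 0)"
      by (simp add: taylor_expansion_upto_def)
    from taylor_expansion_add[OF taylor_expansion_mexp this]
    have "taylor_expansion_upto 0 H (\<lambda>h. ?e i h + h *\<^sub>R ?s i h) (\<lambda>k. ?E i k + 0)" .
    then show ?case
      by (subst (asm) taylor_expansion_cong[OF Y_eq, where T = "S i"]) (auto simp: S0)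
  next
    case (Suc n)
    have "taylor_expansion_upto n H (\<lambda>h. f (Y h $ j)) (composition_coeff f (S j))" for j
    proof (rule taylor_expansion_compose[OF D(1) _ H])
      show "S j 0 \<in> D" using D by (auto simp: S0)
      show "Ck_on (Suc n) D f" by (rule Ck_on_mono[OF f]) (use Suc.prems in simp)
    qed (use Suc in simp)
    then have "taylor_expansion_upto n H (?s i) (\<lambda>k. \<Sum>j\<in>UNIV. a $ i $ j *\<^sub>R composition_coeff f (S j) k)"
      by (intro taylor_expansion_sum taylor_expansion_linear[OF bounded_linear_scaleR_right]) auto
    from taylor_expansion_add[OF taylor_expansion_mexp taylor_expansion_times_Suc[OF this]]
    have "taylor_expansion_upto (Suc n) H (\<lambda>h. ?e i h + h *\<^sub>R ?s i h) (\<lambda>k. ?E i k +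
        (case k of 0 \<Rightarrow> 0 | Suc k \<Rightarrow> \<Sum>j\<in>UNIV. a $ i $ j *\<^sub>R composition_coeff f (S j) k))" .
    then show ?case
      by (subst (asm) taylor_expansion_cong[OF Y_eq, where T = "S i"]) (use S Suc.prems in auto)
  qed
  then show ?thesis by simp
qed

text \<open>An expansion of \<open>u\<close> passes to the right-hand side at the same order, and
  integration gains one. The equation at \<open>h = 0\<close> provides the initial value of
  \<open>u'\<close> that integration asks for.\<close>

lemma taylor_expansion_ode:
  fixes u u' :: "real \<Rightarrow> real^'m" and M :: "real^'m^'m"
  assumes D: "open D" "u 0 \<in> D" and f: "Ck_on (Suc p) D f"
    and H: "is_interval H" "0 \<in> H"
    and der: "\<And>h. h \<in> H \<Longrightarrow> (u has_vector_derivative (- (M *v u h) + f (u h))) (at h within H)"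
    and T: "T 0 = u 0" "\<And>k. k \<le> p \<Longrightarrow> T (Suc k) = (- (M *v T k) + composition_coeff f T k) /\<^sub>R real (Suc k)"
  shows "taylor_expansion_upto (Suc p) H u T"
proof -
  have "taylor_expansion_upto n H u T" if "n \<le> Suc p" for n
    using that
  proof (induction n)
    case 0
    show ?case
      using taylor_expansion_0_differentiable[OF der[OF H(2)]]
      by (rule taylor_expansion_coeff_cong) (simp add: T)
  next
    case (Suc n)
    then have IH: "taylor_expansion_upto n H u T" by simp
    have "taylor_expansion_upto n H (\<lambda>h. f (u h)) (composition_coeff f T)"
    proof (rule taylor_expansion_compose[OF D(1) _ H _ IH])
      show "Ck_on (Suc n) D f" by (rule Ck_on_mono[OF f]) (use Suc.prems in simp)
    qed (simp add: T(1) D(2))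
    from taylor_expansion_add[OF taylor_expansion_linear[OF bounded_linear_minus[OF matrix_vector_mul_bounded_linear] IH] this]
    have "taylor_expansion_upto n H (\<lambda>h. - (M *v u h) + f (u h)) (\<lambda>k. - (M *v T k) + composition_coeff f T k)" .
    from taylor_expansion_integrate[OF this H zero_less_one der]
    have "taylor_expansion_upto (Suc n) H u
        (case_nat (u 0) (\<lambda>k. (- (M *v T k) + composition_coeff f T k) /\<^sub>R real (Suc k)))"
      by (simp add: T(1))
    then show ?case
      by (rule taylor_expansion_coeff_cong) (use T Suc.prems in \<open>auto split: nat.split\<close>)
  qed
  then show ?thesis by simp
qed

section \<open>Explicit coefficients up to order three\<close>

text \<open>The diagonal of the third derivative is enough: to order three it is evaluated only at
  the first coefficient of the inner function, which is always a multiple of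
  \<open>g\<close>.\<close>

definition third_directional_derivative :: "(real^'m \<Rightarrow> real^'m) \<Rightarrow> real^'m \<Rightarrow> real^'m \<Rightarrow> real^'m" where
  "third_directional_derivative f x v =
     frechet_derivative (\<lambda>z. second_derivative f z v v) (at x) v"

lemma composition_coeff_2:
  "composition_coeff f T 2 =
     (1/2) *\<^sub>R second_derivative f (T 0) (T 1) (T 1) + frechet_derivative f (at (T 0)) (T 2)"
  by (simp add: numeral_2_eq_2 second_derivative_def scaleR_add_right)

text \<open>The recursion is not symmetric in the order of differentiation, so the mixed term
  appears in both orders with weights 1/3 and 2/3; symmetry later merges them into weight 1.\<close>

lemma composition_coeff_3:
  "composition_coeff f T 3 =
     (1/6) *\<^sub>R third_directional_derivative f (T 0) (T 1)
     + (1/3) *\<^sub>R second_derivative f (T 0) (T 2) (T 1) + (2/3) *\<^sub>R second_derivative f (T 0) (T 1) (T 2)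
     + frechet_derivative f (at (T 0)) (T 3)"
  by (simp add: numeral_2_eq_2 numeral_3_eq_3 second_derivative_def third_directional_derivative_def scaleR_add_right)

text \<open>Two factors \<open>s\<close> come from the bilinear inner derivative, by an identity on
  all of \<open>D\<close> that can be differentiated; the third comes from linearity of the outer
  derivative.\<close>

lemma third_directional_derivative_scaleR:
  assumes f: "Ck_on 3 D f" and D: "open D" "x \<in> D"
  shows "third_directional_derivative f x (s *\<^sub>R v) = s^3 *\<^sub>R third_directional_derivative f x v"
proof -
  have f3: "Ck_on (Suc (Suc (Suc 0))) D f" using f by (simp add: numeral_3_eq_3 del: Ck_on.simps)
  have f2: "Ck_on (Suc (Suc 0)) D f" using Ck_on_SucE[OF f3] .
  have eq: "s^2 *\<^sub>R second_derivative f z v v = second_derivative f z (s *\<^sub>R v) (s *\<^sub>R v)" if z: "z \<in> D" for z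
    using bounded_linear.linear[OF Ck_on_linear_frechet_derivative[OF Ck_on_SucD(2)[OF f2] z]]
    by (simp add: second_derivative_def frechet_derivative_scaleR_direction[OF f2 D(1) z] linear_scale power2_eq_square)
  have d: "((\<lambda>z. second_derivative f z v v) has_derivative
      frechet_derivative (\<lambda>z. second_derivative f z v v) (at x)) (at x)"
    unfolding second_derivative_def
    using Ck_on_has_derivative[OF Ck_on_SucD(2)[OF Ck_on_SucD(2)[OF f3]] D(2)] .
  from has_derivative_scaleR_right[OF d, of "s^2"]
  have "((\<lambda>z. second_derivative f z (s *\<^sub>R v) (s *\<^sub>R v)) has_derivative
      (\<lambda>w. s^2 *\<^sub>R frechet_derivative (\<lambda>z. second_derivative f z v v) (at x) w)) (at x)"
    by (rule has_derivative_transform_within_open[OF _ D eq])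
  from frechet_derivative_at[OF this, symmetric] show ?thesis
    using has_derivative_linear[OF d]
    by (simp add: third_directional_derivative_def linear_scale power2_eq_square power3_eq_cube mult_ac)
qed

lemma frechet_derivative_eq_jacobian:
  fixes f :: "real^'n \<Rightarrow> real^'m"
  assumes "Ck_on (Suc k) D f" "x \<in> D"
  shows "frechet_derivative f (at x) v = jacobian f (at x) *v v"
proof -
  have "(f has_derivative (\<lambda>v. jacobian f (at x) *v v)) (at x)"
    by (rule jacobian_works[THEN iffD1, OF Ck_on_SucD(1)[OF assms]])
  from frechet_derivative_at[OF this] show ?thesis by (rule fun_cong[OF sym])
qed

text \<open>The first argument is the outer direction, where linearity is that of a derivative; the
  second is the inner one and needs the results on sums and multiples of directions.\<close>

lemma second_derivative_linear:
  assumes f: "Ck_on (Suc (Suc k)) D f" and D: "open D" "x \<in> D"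
  shows "second_derivative f x (u + v) w = second_derivative f x u w + second_derivative f x v w"
    and "second_derivative f x (s *\<^sub>R u) w = s *\<^sub>R second_derivative f x u w"
    and "second_derivative f x w (u + v) = second_derivative f x w u + second_derivative f x w v"
    and "second_derivative f x w (s *\<^sub>R u) = s *\<^sub>R second_derivative f x w u"
    and "second_derivative f x v w = second_derivative f x w v"
proof -
  have lin: "linear (frechet_derivative (\<lambda>z. frechet_derivative f (at z) w) (at x))" for w
    using bounded_linear.linear[OF Ck_on_linear_frechet_derivative[OF Ck_on_SucD(2)[OF f] D(2)]] .
  show "second_derivative f x (u + v) w = second_derivative f x u w + second_derivative f x v w"
    and "second_derivative f x (s *\<^sub>R u) w = s *\<^sub>R second_derivative f x u w"
    using lin[of w] by (simp_all add: second_derivative_def linear_add linear_scale)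
  show "second_derivative f x w (u + v) = second_derivative f x w u + second_derivative f x w v"
    and "second_derivative f x w (s *\<^sub>R u) = s *\<^sub>R second_derivative f x w u"
    by (simp_all add: second_derivative_def frechet_derivative_add_direction[OF f D]
        frechet_derivative_scaleR_direction[OF f D])
  show "second_derivative f x v w = second_derivative f x w v"
    unfolding second_derivative_def by (rule frechet_derivative_commute[OF D f])
qed

subsection \<open>Order four\<close>

theorem theorem3p1:
  fixes M :: "real^'m^'m" and f :: "real^'m \<Rightarrow> real^'m" and D :: "(real^'m) set"
    and t0 :: real and y0 :: "real^'m" and I :: "real set" and y y' :: "real \<Rightarrow> real^'m"
    and a :: "real^2^2" and b c :: "real^2"
  assumes "open D" and "y0 \<in> D" and "Ck_on 4 D f"
    and "is_interval I" and "t0 \<in> I"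
    and "\<And>t. t \<in> I \<Longrightarrow> (y has_vector_derivative y' t) (at t within I)"
    and "\<And>t. t \<in> I \<Longrightarrow> y' t + M *v y t = f (y t)"
    and "y t0 = y0"
    and "c $ 1 = a $ 1 $ 1 + a $ 1 $ 2" and "c $ 2 = a $ 2 $ 1 + a $ 2 $ 2"
    and "b $ 1 + b $ 2 = 1"
    and "b $ 1 * c $ 1 + b $ 2 * c $ 2 = 1 / 2"
    and "b $ 1 * (c $ 1)^2 + b $ 2 * (c $ 2)^2 = 1 / 3"
    and "b $ 1 * (a $ 1 $ 1 * c $ 1 + a $ 1 $ 2 * c $ 2)
         + b $ 2 * (a $ 2 $ 1 * c $ 1 + a $ 2 $ 2 * c $ 2) = 1 / 6"
    and "b $ 1 * (c $ 1)^3 + b $ 2 * (c $ 2)^3 = 1 / 4"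
    and "b $ 1 * c $ 1 * (a $ 1 $ 1 * c $ 1 + a $ 1 $ 2 * c $ 2)
         + b $ 2 * c $ 2 * (a $ 2 $ 1 * c $ 1 + a $ 2 $ 2 * c $ 2) = 1 / 8"
    and "b $ 1 * (a $ 1 $ 1 * (c $ 1)^2 + a $ 1 $ 2 * (c $ 2)^2)
         + b $ 2 * (a $ 2 $ 1 * (c $ 1)^2 + a $ 2 $ 2 * (c $ 2)^2) = 1 / 12"
    and "(b $ 1 * a $ 1 $ 1 + b $ 2 * a $ 2 $ 1) * (a $ 1 $ 1 * c $ 1 + a $ 1 $ 2 * c $ 2)
         + (b $ 1 * a $ 1 $ 2 + b $ 2 * a $ 2 $ 2) * (a $ 2 $ 1 * c $ 1 + a $ 2 $ 2 * c $ 2) = 1 / 24"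
  shows "sverk_has_order 4 a b c M f t0 y0 I y"
proof -
  note f = assms(3)
  have f4: "Ck_on (Suc 3) D f" and f3: "Ck_on 3 D f" and f2: "Ck_on (Suc (Suc 0)) D f" and f1: "Ck_on (Suc 0) D f"
    by (rule Ck_on_mono[OF f], simp)+
  define H where "H = {h. t0 + h \<in> I}"
  have H: "is_interval H" "0 \<in> H"
  proof -
    show "is_interval H" unfolding is_interval_1
    proof (intro ballI allI impI)
      fix u v x assume "u \<in> H" "v \<in> H" "u \<le> x \<and> x \<le> v"
      then show "x \<in> H"
        using mem_is_interval_1_I[OF assms(4), of "t0 + u" "t0 + v" "t0 + x"] by (simp add: H_def)
    qed
    show "0 \<in> H" using assms(5) by (simp add: H_def)
  qed
  obtain r where r: "r > 0" "cball y0 r \<subseteq> D" using assms(1,2) open_contains_cball by blast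
  define J where "J = jacobian f (at y0)"
  define F where "F = second_derivative f y0"
  define g where "g = vector_field M f y0"
  define X where "X = third_directional_derivative f y0 g"
  have J: "frechet_derivative f (at y0) v = J *v v" for v
    unfolding J_def by (rule frechet_derivative_eq_jacobian[OF f1 assms(2)])
  note F = second_derivative_linear[OF f2 assms(1,2), folded F_def]
  have X: "third_directional_derivative f y0 (s *\<^sub>R g) = s^3 *\<^sub>R X" for s
    unfolding X_def by (rule third_directional_derivative_scaleR[OF f3 assms(1,2)])
  have g: "f y0 = g + M *v y0" by (simp add: g_def vector_field_def)
  have cc: "composition_coeff f S 0 = f y0" "composition_coeff f S (Suc 0) = J *v S 1"
    "composition_coeff f S 2 = (1/2) *\<^sub>R F (S 1) (S 1) + J *v S 2"
    "composition_coeff f S 3 = (1/6) *\<^sub>R third_directional_derivative f y0 (S 1) + F (S 1) (S 2) + J *v S 3"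
    if "S 0 = y0" for S
  proof -
    show "composition_coeff f S 3 = (1/6) *\<^sub>R third_directional_derivative f y0 (S 1) + F (S 1) (S 2) + J *v S 3"
      using F(5)[of "S 2" "S 1"] scaleR_left_distrib[of "1/3" "2/3" "F (S 1) (S 2)"]
      by (simp add: composition_coeff_3 that J flip: F_def)
  qed (simp_all add: composition_coeff_2 that J flip: F_def)
  \<comment> \<open>\<open>K\<close> is the Jacobian of the vector field at \<open>y0\<close>. As
    \<open>M\<close> is constant, higher derivatives of the field are those of \<open>f\<close>, and
    \<open>fact k *\<^sub>R T k\<close> for \<open>k \<le> 4\<close> is the \<open>k\<close>-th
    derivative of the solution at \<open>t0\<close>.\<close>
  define K where "K v = - (M *v v) + J *v v" for v
  define T where "T k = (if k = 0 then y0 else if k = 1 then g else if k = 2 then (1/2) *\<^sub>R K g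
     else if k = 3 then (1/6) *\<^sub>R (K (K g) + F g g)
     else (1/24) *\<^sub>R (X + 3 *\<^sub>R F g (K g) + K (F g g) + K (K (K g))))" for k :: nat
  have exact: "taylor_expansion_upto 4 H (\<lambda>h. y (t0 + h)) T"
  proof -
    have "taylor_expansion_upto (Suc 3) H (\<lambda>h. y (t0 + h)) T"
    proof (rule taylor_expansion_ode[OF assms(1) _ f4 H])
      fix h assume h: "h \<in> H"
      \<comment> \<open>The chain rule asks for the derivative of \<open>y\<close> within the image
        of \<open>H\<close> under the shift, so that image is identified with
        \<open>I\<close>.\<close>
      have "x \<in> (+) t0 ` H" if "x \<in> I" for x
        by (rule image_eqI[of _ _ "x - t0"]) (use that in \<open>simp_all add: H_def\<close>)
      then have "(+) t0 ` H = I" by (auto simp: H_def)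
      then have "(y has_vector_derivative y' (t0 + h)) (at (t0 + h) within (+) t0 ` H)"
        using assms(6) h by (simp add: H_def)
      moreover have "((+) t0 has_vector_derivative 1) (at h within H)"
        by (auto intro!: derivative_eq_intros simp flip: has_real_derivative_iff_has_vector_derivative)
      ultimately have "((\<lambda>h. y (t0 + h)) has_vector_derivative y' (t0 + h)) (at h within H)"
        using vector_diff_chain_within[of "(+) t0" 1 h H y "y' (t0 + h)"] by (simp add: o_def)
      moreover have "y' (t0 + h) = - (M *v y (t0 + h)) + f (y (t0 + h))"
        using assms(7)[of "t0 + h"] h by (simp add: H_def algebra_simps)
      ultimately show "((\<lambda>h. y (t0 + h)) has_vector_derivative - (M *v y (t0 + h)) + f (y (t0 + h))) (at h within H)"
        by simp
    next
      fix k :: nat assume "k \<le> 3"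
      then consider "k = 0" | "k = 1" | "k = 2" | "k = 3" by linarith
      then show "T (Suc k) = (- (M *v T k) + composition_coeff f T k) /\<^sub>R real (Suc k)"
      proof cases
        case 1 then show ?thesis using cc(1)[of T] by (simp add: T_def g)
      next
        case 2 then show ?thesis using cc(2)[of T] by (simp add: T_def K_def)
      next
        case 3
        have "composition_coeff f T 2 = (1/2) *\<^sub>R F g g + (1/2) *\<^sub>R (J *v K g)"
          using cc(3)[of T] by (simp add: T_def matrix_vector_mult_scaleR)
        then show ?thesis using 3
          by (simp add: T_def K_def[of "K g"] matrix_vector_mult_scaleR vec_eq_iff field_simps)
      next
        case 4
        have e1: "T 4 = (1/24) *\<^sub>R (X + 3 *\<^sub>R F g (K g) + K (F g g) + K (K (K g)))" by (simp add: T_def)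
        have e2: "composition_coeff f T 3 = (1/6) *\<^sub>R X + (1/2) *\<^sub>R F g (K g)
            + (1/6) *\<^sub>R (J *v (K (K g) + F g g))"
          using cc(4)[of T] X[of 1] by (simp add: T_def F matrix_vector_mult_scaleR)
        have e3: "M *v T 3 = (1/6) *\<^sub>R (M *v (K (K g) + F g g))"
          by (simp add: T_def matrix_vector_mult_scaleR)
        show ?thesis using 4
          by (simp add: e1 e2 e3 K_def[of "F g g"] K_def[of "K (K g)"] matrix_vector_right_distrib vec_eq_iff field_simps)
      qed
    qed (simp_all add: T_def assms(2,8))
    then show ?thesis by simp
  qed
  define A where "A i = (\<Sum>j\<in>UNIV. a $ i $ j * c $ j)" for i
  define Q where "Q i = (\<Sum>j\<in>UNIV. a $ i $ j * (c $ j)^2)" for i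
  define R where "R i = (\<Sum>j\<in>UNIV. a $ i $ j * A j)" for i
  \<comment> \<open>The linear coefficient is \<open>c $ i *\<^sub>R (f y0 - M *v y0)\<close> by the
    row sums. In the quadratic one, the exact value at time \<open>c $ i * h\<close> would also
    contain a multiple of \<open>M *v f y0\<close>; its absence from the stages is one source of the
    corrections in \<open>w4\<close>.\<close>
  define S where "S i k = (if k = 0 then y0 else if k = 1 then c $ i *\<^sub>R g
     else if k = 2 then ((c $ i)^2 / 2) *\<^sub>R (M *v (M *v y0)) + A i *\<^sub>R (J *v g)
     else - ((c $ i)^3 / 6) *\<^sub>R (M *v (M *v (M *v y0))) + (Q i / 2) *\<^sub>R (J *v (M *v (M *v y0)) + F g g)
       + R i *\<^sub>R (J *v (J *v g)))" for i and k :: nat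
  have S_rec: "S i k = ((- (c $ i))^k / fact k) *\<^sub>R (matpow M k *v y0) +
      (case k of 0 \<Rightarrow> 0 | Suc k \<Rightarrow> \<Sum>j\<in>UNIV. a $ i $ j *\<^sub>R composition_coeff f (S j) k)" if k: "k \<le> 3" for i k
  proof -
    have ccS: "composition_coeff f (S j) 0 = f y0" "composition_coeff f (S j) (Suc 0) = c $ j *\<^sub>R (J *v g)"
      "composition_coeff f (S j) 2 = ((c $ j)^2 / 2) *\<^sub>R (J *v (M *v (M *v y0)) + F g g) + A j *\<^sub>R (J *v (J *v g))" for j
    proof -
      show "composition_coeff f (S j) 2 = ((c $ j)^2 / 2) *\<^sub>R (J *v (M *v (M *v y0)) + F g g) + A j *\<^sub>R (J *v (J *v g))"
        using cc(3)[of "S j"]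
        by (simp add: S_def F matrix_vector_right_distrib matrix_vector_mult_scaleR vec_eq_iff power2_eq_square field_simps)
    qed (use cc(1,2)[of "S j"] in \<open>simp_all add: S_def matrix_vector_mult_scaleR\<close>)
    consider "k = 0" | "k = 1" | "k = 2" | "k = 3" using k by linarith
    then show ?thesis
    proof cases
      case 1 then show ?thesis by (simp add: S_def)
    next
      case 2
      have c: "c $ i = (\<Sum>j\<in>UNIV. a $ i $ j)" using assms(9,10) exhaust_2[of i] by (auto simp: sum_2)
      have "(\<Sum>j\<in>UNIV. a $ i $ j *\<^sub>R composition_coeff f (S j) 0) = c $ i *\<^sub>R (g + M *v y0)"
        unfolding c scaleR_sum_left ccS(1) g ..
      then show ?thesis using 2 by (simp add: S_def scaleR_add_right del: composition_coeff.simps)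
    next
      case 3
      have "(\<Sum>j\<in>UNIV. a $ i $ j *\<^sub>R composition_coeff f (S j) (Suc 0)) = A i *\<^sub>R (J *v g)"
        unfolding ccS(2) A_def scaleR_sum_left by simp
      moreover have "matpow M 2 *v y0 = M *v (M *v y0)"
        by (simp add: numeral_2_eq_2 matrix_vector_mul_assoc)
      ultimately show ?thesis using 3 by (simp add: S_def del: composition_coeff.simps)
    next
      case 4
      have "(\<Sum>j\<in>UNIV. a $ i $ j *\<^sub>R composition_coeff f (S j) 2) =
         (Q i / 2) *\<^sub>R (J *v (M *v (M *v y0)) + F g g) + R i *\<^sub>R (J *v (J *v g))"
        unfolding ccS Q_def R_def by (simp add: sum_2 vec_eq_iff field_simps)
      moreover have "matpow M 3 *v y0 = M *v (M *v (M *v y0))"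
        by (simp add: numeral_3_eq_3 matrix_vector_mul_assoc)
      moreover have "fact 3 = (6::real)" by (simp add: fact_numeral)
      ultimately show ?thesis using 4 by (simp add: S_def)
    qed
  qed
  \<comment> \<open>At \<open>h^2\<close> the exact coefficient is half of
    \<open>M *v (M *v y0) - M *v f y0 + J *v g\<close>. The exponential gives the first term, the
    stages the last, and \<open>W 2\<close> the middle one; \<open>W 3\<close> and
    \<open>W 4\<close> fill the gaps at the next two powers in the same way.\<close>
  define W where "W k = (if k = 2 then - ((1/2) *\<^sub>R (M *v f y0))
     else if k = 3 then (1/6) *\<^sub>R ((M - J) *v (M *v f y0) - M *v (J *v g))
     else if k = 4 then (1/24) *\<^sub>R
          ((- M + J) *v (M *v (M *v f y0)) + M *v (M *v (J *v g)) - M *v F g g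
           - M *v (J *v ((- M + J) *v g)) - J *v (M *v (J *v g)) - J *v (J *v (M *v f y0))
           + 3 *\<^sub>R F (- (M *v f y0)) g) else 0)" for k :: nat
  have neg: "M' *v (- v) = - (M' *v v)" for M' :: "real^'m^'m" and v
    using linear_neg[OF matrix_vector_mul_linear] .
  have F_neg: "F (- u) v = - F u v" "F u (- v) = - F u v" for u v
    using F(2)[of "-1" u v] F(4)[of u "-1" v] by simp_all
  have F_diff: "F (u - v) w = F u w - F v w" "F w (u - v) = F w u - F w v" for u v w
    using F(1)[of u "- v" w] F(3)[of w u "- v"] by (simp_all add: F_neg)
  have coeff_eq: "((- 1)^k / fact k) *\<^sub>R (matpow M k *v y0)
      + (case k of 0 \<Rightarrow> 0 | Suc k \<Rightarrow> \<Sum>i\<in>UNIV. b $ i *\<^sub>R composition_coeff f (S i) k) + W k = T k"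
    if k: "k \<le> 4" for k
  proof -
    have S0: "S i 0 = y0" for i by (simp add: S_def)
    note ccS = cc[of "S i" for i, OF S0]
    note dist = matrix_vector_right_distrib matrix_vector_mult_diff_distrib matrix_vector_mult_add_rdistrib
      matrix_vector_mult_diff_rdistrib matrix_vector_mult_scaleR neg F(1-4) F_neg F_diff
    have mJ: "- M + J = J - M" by simp
    have pow: "matpow M 2 *v y0 = M *v (M *v y0)" "matpow M 3 *v y0 = M *v (M *v (M *v y0))"
       "matpow M 4 *v y0 = M *v (M *v (M *v (M *v y0)))"
      by (simp_all add: numeral_eq_Suc matrix_vector_mul_assoc)
    have facts: "fact 3 = (6::real)" "fact 4 = (24::real)" by (simp_all add: fact_numeral)
    consider "k = 0" | "k = 1" | "k = 2" | "k = 3" | "k = 4" using k by linarith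
    then show ?thesis
    proof cases
      case 1
      then show ?thesis by (simp add: T_def W_def)
    next
      case 2
      have "(\<Sum>i\<in>UNIV. b $ i *\<^sub>R f y0) = f y0"
        using assms(11) by (simp add: sum_2 flip: scaleR_left_distrib)
      then show ?thesis using 2 by (simp add: T_def W_def S_def g)
    next
      case 3
      have "(\<Sum>i\<in>UNIV. b $ i *\<^sub>R composition_coeff f (S i) (Suc 0)) =
          (b $ 1 * c $ 1 + b $ 2 * c $ 2) *\<^sub>R (J *v g)"
        unfolding ccS(2) by (simp add: S_def sum_2 dist scaleR_left_distrib)
      also note assms(12)
      finally show ?thesis using 3
        by (simp add: T_def W_def K_def pow g dist mJ vec_eq_iff field_simps)
    next
      case 4
      have "(\<Sum>i\<in>UNIV. b $ i *\<^sub>R composition_coeff f (S i) 2) =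
          (b $ 1 * (c $ 1)^2 + b $ 2 * (c $ 2)^2) *\<^sub>R ((1/2) *\<^sub>R (F g g + J *v (M *v (M *v y0))))
          + (b $ 1 * A 1 + b $ 2 * A 2) *\<^sub>R (J *v (J *v g))"
        unfolding ccS(3) by (simp add: S_def sum_2 dist vec_eq_iff power2_eq_square field_simps)
      also have "b $ 1 * A 1 + b $ 2 * A 2 = 1/6" using assms(14) by (simp add: A_def sum_2)
      also note assms(13)
      finally show ?thesis using 4
        by (simp add: T_def W_def K_def pow facts g dist mJ vec_eq_iff field_simps)
    next
      case 5
      \<comment> \<open>Terms with powers of \<open>M\<close> at \<open>y0\<close> stem from the
        exponentials in the stages and share the weight of an elementary differential of
        \<open>f\<close>. Four weights remain, fixed by the conditions with 1/4, 1/8, 1/12 and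
        1/24.\<close>
      have "(\<Sum>i\<in>UNIV. b $ i *\<^sub>R composition_coeff f (S i) 3) =
          (b $ 1 * (c $ 1)^3 + b $ 2 * (c $ 2)^3) *\<^sub>R
            ((1/6) *\<^sub>R X + (1/2) *\<^sub>R F g (M *v (M *v y0)) - (1/6) *\<^sub>R (J *v (M *v (M *v (M *v y0)))))
          + (b $ 1 * c $ 1 * A 1 + b $ 2 * c $ 2 * A 2) *\<^sub>R F g (J *v g)
          + (b $ 1 * Q 1 + b $ 2 * Q 2) *\<^sub>R ((1/2) *\<^sub>R (J *v (J *v (M *v (M *v y0))) + J *v F g g))
          + (b $ 1 * R 1 + b $ 2 * R 2) *\<^sub>R (J *v (J *v (J *v g)))"
        unfolding ccS(4)
        by (simp add: S_def sum_2 X dist vec_eq_iff power2_eq_square power3_eq_cube field_simps)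
      also have "b $ 1 * c $ 1 * A 1 + b $ 2 * c $ 2 * A 2 = 1/8" using assms(16) by (simp add: A_def sum_2)
      also have "b $ 1 * Q 1 + b $ 2 * Q 2 = 1/12" using assms(17) by (simp add: Q_def sum_2)
      also have "b $ 1 * R 1 + b $ 2 * R 2 = 1/24" using assms(18) by (simp add: R_def A_def sum_2 algebra_simps)
      also note assms(15)
      finally show ?thesis using 5
        \<comment> \<open>\<open>w4\<close> has \<open>M *v f y0\<close> in the first slot of
          \<open>F\<close>, the exact solution has \<open>K g\<close> in the second. After
          \<open>f y0\<close> is split, the two instances of symmetry turn the terms of
          \<open>w4\<close> around.\<close>
        by (simp add: T_def W_def K_def pow facts g dist mJ F(5)[of "M *v g" g] F(5)[of "M *v (M *v y0)" g] vec_eq_iff field_simps)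
    qed
  qed
  show ?thesis unfolding sverk_has_order_def H_def[symmetric]
  proof (intro exI[of _ r] conjI allI impI)
    show "r > 0" by (rule r)
    show "\<forall>\<^sub>F h in nhds 0. \<exists>!Y. (\<forall>i. Y $ i \<in> ball y0 r) \<and> sverk_stages a c M f y0 h Y"
      by (rule sverk_stages_ex1[OF r(2,1) f1])
    fix Y :: "real \<Rightarrow> (real^'m)^2"
    assume Y: "\<forall>\<^sub>F h in at 0 within H. (\<forall>i. Y h $ i \<in> ball y0 r) \<and> sverk_stages a c M f y0 h (Y h)"
    \<comment> \<open>Order three suffices because the update multiplies \<open>f\<close> along the
      stages by \<open>h\<close>.\<close>
    have YS: "taylor_expansion_upto 3 H (\<lambda>h. Y h $ i) (S i)" for i
      by (rule taylor_expansion_stages[OF assms(1) r(2,1) f4 H Y S_rec])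
    have fY: "taylor_expansion_upto 3 H (\<lambda>h. f (Y h $ i)) (composition_coeff f (S i))" for i
      by (rule taylor_expansion_compose[OF assms(1) _ H f4 YS]) (simp add: S_def assms(2))
    have "w4 M f y0 h = (\<Sum>k\<le>4. h^k *\<^sub>R W k)" for h
      by (simp add: w4_def Let_def W_def fact_numeral numeral_eq_Suc flip: J_def F_def g_def)
    then have w4: "taylor_expansion_upto 4 H (w4 M f y0) W"
      by (simp add: taylor_expansion_upto_def)
    let ?B = "\<lambda>k. \<Sum>i\<in>UNIV. b $ i *\<^sub>R composition_coeff f (S i) k"
    have "taylor_expansion_upto 3 H (\<lambda>h. \<Sum>i\<in>UNIV. b $ i *\<^sub>R f (Y h $ i)) ?B"
      by (intro taylor_expansion_sum taylor_expansion_linear[OF bounded_linear_scaleR_right] fY) auto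
    from taylor_expansion_times_Suc[OF this]
    have "taylor_expansion_upto 4 H (\<lambda>h. h *\<^sub>R (\<Sum>i\<in>UNIV. b $ i *\<^sub>R f (Y h $ i))) (case_nat 0 ?B)"
      by simp
    from taylor_expansion_add[OF taylor_expansion_add[OF taylor_expansion_mexp[where s = 1] this] w4]
    have "taylor_expansion_upto 4 H (\<lambda>h. sverk_update b M f y0 h (Y h))
       (\<lambda>k. ((- 1)^k / fact k) *\<^sub>R (matpow M k *v y0) + case_nat 0 ?B k + W k)"
      by (simp add: sverk_update_def)
    moreover have "((- 1)^k / fact k) *\<^sub>R (matpow M k *v y0) + case_nat 0 ?B k + W k = T k" if "k \<le> 4" for k
      using coeff_eq[OF that] unfolding W_def .
    ultimately have "taylor_expansion_upto 4 H (\<lambda>h. sverk_update b M f y0 h (Y h)) T"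
      by (rule taylor_expansion_coeff_cong)
    with exact show "taylor_expansions_coincide 4 H (\<lambda>h. sverk_update b M f y0 h (Y h)) (\<lambda>h. y (t0 + h))"
      unfolding taylor_expansions_coincide_def by blast
  qed
qed

end
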